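(* Let $\mathcal M,\mu,\mathcal B,\mathcal E$, the Marcinkiewicz-Zygmund family with nodes $\{x_{m,j}\}$, weights $\{\tau_{m,j}\}$, degrees $\{r_m\}$ and constants $A,B$, the space $Y=H^\sigma(\mathcal B,\mathcal E)$, the Banach space $X$ with subspaces $\{G_m\}_{m\in\mathbb N}$, and the bounded linear operator $F\colon X\to Y$ satisfy all the assumptions listed in the context, and let $\mathcal S,\mathcal L$ be the orthonormal system and the sequence adapted to $F$ constructed in the context. Let $\sigma\ge\zeta\ge0$. Let $f^\dagger\in X$ be such that $Ff^\dagger$ is continuous, let $m\in\mathbb N$, let $\beta\ge0$, and let $\{y_{m,j}\}_{j=1}^{L_m}$ be such that $$|y_{m,j}-Ff^\dagger(x_{m,j})|\le\beta,\qquad j=1,\dots,L_m .$$ Let $$p_m^\beta\in\operatorname*{argmin}_{p\in G_m}\sum_{j=1}^{L_m}|y_{m,j}-Fp(x_{m,j})|^2\,\tau_{m,j}.$$ Then, with $\kappa=B/A$, $$\|Ff^\dagger-Fp_m^\beta\|_{H^\zeta(\mathcal S,\mathcal L)}\le\sqrt{1+\kappa}\,\|Ff^\dagger\|_{H^\sigma(\mathcal S,\mathcal L)}\,\phi_{\sigma-\zeta}(r_m,\mathcal S,\mathcal L)+\sqrt\kappa\,\beta\,(1+r_m^2)^{\frac\zeta2}.$$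
   Context: $\mathbb N=\{0,1,2,\dots\}$. General notation. Let $\mathcal M$ be a topological space with a probability measure $\mu$; $\langle\cdot,\cdot\rangle_2$, $\|\cdot\|_2$ are the inner product and norm of $L^2(\mathcal M,\mu)$ (complex valued). For an orthonormal system $\mathcal S=\{\psi_k\}_{k\in\mathbb N}$ of continuous bounded functions with $\psi_0\equiv1$ and a non-decreasing sequence $\mathcal L=\{\Lambda_k\}_{k\in\mathbb N}$, $\Lambda_k\ge0$, $\Lambda_k\to+\infty$, put: $H(\mathcal S)=\overline{\operatorname{span}\{\psi_k\}}$ in $L^2$; $\|f\|_{H^s(\mathcal S,\mathcal L)}=\big(\sum_k|\langle f,\psi_k\rangle_2|^2(1+\Lambda_k^2)^s\big)^{1/2}\in[0,\infty]$ and $H^s(\mathcal S,\mathcal L)=\{f\in H(\mathcal S):\|f\|_{H^s(\mathcal S,\mathcal L)}<\infty\}$ for $s\ge0$; $\mathcal Q_r(\mathcal S,\mathcal L)=\operatorname{span}\{\psi_k:\Lambda_k\le r\}$; and $\phi_s(r,\mathcal S,\mathcal L)=\sup_{x\in\mathcal M}\big(\sum_{k:\Lambda_k>r}|\psi_k(x)|^2(1+\Lambda_k^2)^{-s}\big)^{1/2}\in[0,\infty]$. Assumption on $Y$. $\mathcal B=\{\varphi_k\}_{k\in\mathbb N}$ is an orthonormal basis of $L^2(\mathcal M,\mu)$, each $\varphi_k$ continuous and bounded, $\varphi_0\equiv1$; $\mathcal E=\{\lambda_k\}_{k\in\mathbb N}$, $\lambda_k\ge0$, is non-decreasing with $\lambda_k\to+\infty$.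 There is a Marcinkiewicz-Zygmund family for $\mathcal B$ and $\mathcal E$, i.e. nodes $\{x_{m,j}:m\in\mathbb N,\ j=1,\dots,L_m\}\subseteq\mathcal M$, positive weights $\{\tau_{m,j}\}$ and a non-negative increasing sequence of degrees $\{r_m\}$ diverging to $+\infty$, with $$A\|q\|_2^2\le\sum_{j=1}^{L_m}|q(x_{m,j})|^2\tau_{m,j}\le B\|q\|_2^2\quad\text{for all }q\in\mathcal Q_{r_m}(\mathcal B,\mathcal E),$$ with constants $A,B>0$ independent of $m$. $Y=H^\sigma(\mathcal B,\mathcal E)$ for some $\sigma\ge0$. Assumption on $X$. $X$ is a Banach space with a family $\{G_m\}_{m\in\mathbb N}$ of finite-dimensional subspaces such that $G_m\subseteq G_{m+1}$ and $\overline{\bigcup_mG_m}=X$. Assumption on $F$. $F\colon X\to Y$ is linear and bounded, $F(G_m)\subseteq\mathcal Q_{r_m}(\mathcal B,\mathcal E)$ for all $m$, the constant function $1$ belongs to $F(G_0)$, and $\dim\operatorname{Im}F=+\infty$. Construction of $\mathcal S,\mathcal L$. Let $\mathcal S_0=\{\psi_k:0\le k\le d_0\}$ be an orthonormal basis (in $L^2(\mathcal M,\mu)$) of $F(G_0)$ with $\psi_0\equiv1$, and put $\Lambda_k=r_0$ for $0\le k\le d_0$. Inductively, for $m\ge0$ complete $\mathcal S_m$ (if necessary) to an orthonormal basis $\mathcal S_{m+1}=\{\psi_k:0\le k\le d_{m+1}\}$ of $F(G_{m+1})$ and put $\Lambda_k=r_{m+1}$ for $d_m+1\le k\le d_{m+1}$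 (if any). Then $\mathcal S=\{\psi_k:k\in\mathbb N\}$ and $\mathcal L=\{\Lambda_k:k\in\mathbb N\}$; one has $\Lambda_k\to+\infty$ and $\mathcal Q_{r_m}(\mathcal S,\mathcal L)=F(G_m)$.
   Formalization: As the measure is not assumed to have full support, the values of the L² class Ff† at nodes outside the support are undefined; the data bound is required for every continuous representative of Ff†, which is the stated bound whenever the nodes lie in the support. *)

theory Defs
  imports "HOL-Analysis.Analysis" "HOL-Probability.Probability_Measure" "HOL-Library.Function_Algebras"
begin

text \<open>
  Elements of the complex space \<open>L\<^sup>2(\<mu>)\<close> are represented by square-integrable functions
  \<open>'a \<Rightarrow> complex\<close>; two functions represent the same element iff they agree almost everywhere.
  Norms and inner products only depend on the element, and identities between elements are
  stated almost everywhere.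
\<close>

global_interpretation cfun: vector_space "\<lambda>(c :: complex) (f :: 'a \<Rightarrow> complex) x. c * f x"
  defines cfun_span = cfun.span
  by unfold_locales (auto simp: fun_eq_iff algebra_simps)

definition L2_space :: "'a measure \<Rightarrow> ('a \<Rightarrow> complex) set" where
  "L2_space \<mu> = {f \<in> borel_measurable \<mu>. integrable \<mu> (\<lambda>x. (cmod (f x))\<^sup>2)}"

definition L2_inner :: "'a measure \<Rightarrow> ('a \<Rightarrow> complex) \<Rightarrow> ('a \<Rightarrow> complex) \<Rightarrow> complex" where
  "L2_inner \<mu> f g = (\<integral>x. f x * cnj (g x) \<partial>\<mu>)"

definition L2_norm :: "'a measure \<Rightarrow> ('a \<Rightarrow> complex) \<Rightarrow> real" where
  "L2_norm \<mu> f = sqrt (\<integral>x. (cmod (f x))\<^sup>2 \<partial>\<mu>)"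

definition L2_closure :: "'a measure \<Rightarrow> ('a \<Rightarrow> complex) set \<Rightarrow> ('a \<Rightarrow> complex) set" where
  "L2_closure \<mu> V = {f \<in> L2_space \<mu>. \<forall>\<epsilon>>0. \<exists>v\<in>V. L2_norm \<mu> (\<lambda>x. f x - v x) < \<epsilon>}"

definition L2_orthonormal :: "'a measure \<Rightarrow> 'i set \<Rightarrow> ('i \<Rightarrow> 'a \<Rightarrow> complex) \<Rightarrow> bool" where
  "L2_orthonormal \<mu> I \<psi> \<longleftrightarrow>
     (\<forall>i\<in>I. \<psi> i \<in> L2_space \<mu>) \<and>
     (\<forall>i\<in>I. \<forall>j\<in>I. L2_inner \<mu> (\<psi> i) (\<psi> j) = (if i = j then 1 else 0))"

definition L2_infinite_dim :: "'a measure \<Rightarrow> ('a \<Rightarrow> complex) set \<Rightarrow> bool" where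
  "L2_infinite_dim \<mu> V \<longleftrightarrow>
     \<not> (\<exists>T\<subseteq>V. finite T \<and> (\<forall>f\<in>V. \<exists>g\<in>cfun_span T. AE x in \<mu>. f x = g x))"

text \<open>
  The topological support of \<open>\<mu>\<close> need not be the whole space. Off the support, the point values of
  a continuous function are not determined by its class in \<open>L\<^sup>2(\<mu>)\<close>, so a class may have several
  continuous versions; conditions on its point values are imposed on each of them.
\<close>

definition continuous_version ::
  "'a::topological_space measure \<Rightarrow> ('a \<Rightarrow> complex) \<Rightarrow> ('a \<Rightarrow> complex) \<Rightarrow> bool" where
  "continuous_version \<mu> f u \<longleftrightarrow> continuous_on UNIV u \<and> (AE x in \<mu>. u x = f x)"

definition ennreal_sqrt :: "ennreal \<Rightarrow> ennreal" where
  "ennreal_sqrt t = (if t = \<infinity> then \<infinity> else ennreal (sqrt (enn2real t)))"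

definition sobolev_norm ::
  "'a measure \<Rightarrow> (nat \<Rightarrow> 'a \<Rightarrow> complex) \<Rightarrow> (nat \<Rightarrow> real) \<Rightarrow> real \<Rightarrow> ('a \<Rightarrow> complex) \<Rightarrow> ennreal" where
  "sobolev_norm \<mu> \<psi> \<Lambda> s f =
     ennreal_sqrt (\<Sum>k. ennreal ((cmod (L2_inner \<mu> f (\<psi> k)))\<^sup>2 * (1 + (\<Lambda> k)\<^sup>2) powr s))"

definition sobolev_space ::
  "'a measure \<Rightarrow> (nat \<Rightarrow> 'a \<Rightarrow> complex) \<Rightarrow> (nat \<Rightarrow> real) \<Rightarrow> real \<Rightarrow> ('a \<Rightarrow> complex) set" where
  "sobolev_space \<mu> \<psi> \<Lambda> s =
     {f \<in> L2_closure \<mu> (cfun_span (range \<psi>)). sobolev_norm \<mu> \<psi> \<Lambda> s f < \<infinity>}"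

definition diffusion_poly ::
  "(nat \<Rightarrow> 'a \<Rightarrow> complex) \<Rightarrow> (nat \<Rightarrow> real) \<Rightarrow> real \<Rightarrow> ('a \<Rightarrow> complex) set" where
  "diffusion_poly \<psi> \<Lambda> r = cfun_span (\<psi> ` {k. \<Lambda> k \<le> r})"

definition tail_sup ::
  "(nat \<Rightarrow> 'a \<Rightarrow> complex) \<Rightarrow> (nat \<Rightarrow> real) \<Rightarrow> real \<Rightarrow> real \<Rightarrow> ennreal" where
  "tail_sup \<psi> \<Lambda> s r =
     (SUP x. ennreal_sqrt (\<Sum>k. if \<Lambda> k > r
        then ennreal ((cmod (\<psi> k x))\<^sup>2 * (1 + (\<Lambda> k)\<^sup>2) powr (- s)) else 0))"

definition spectral_basis ::
  "'a::topological_space measure \<Rightarrow> (nat \<Rightarrow> 'a \<Rightarrow> complex) \<Rightarrow> (nat \<Rightarrow> real) \<Rightarrow> bool" where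
  "spectral_basis \<mu> \<phi> lam \<longleftrightarrow>
     L2_orthonormal \<mu> UNIV \<phi> \<and>
     L2_closure \<mu> (cfun_span (range \<phi>)) = L2_space \<mu> \<and>
     (\<forall>k. continuous_on UNIV (\<phi> k) \<and> bounded (range (\<phi> k))) \<and>
     \<phi> 0 = (\<lambda>_. 1) \<and>
     (\<forall>k. lam k \<ge> 0) \<and> incseq lam \<and> filterlim lam at_top sequentially"

definition marcinkiewicz_zygmund ::
  "'a measure \<Rightarrow> (nat \<Rightarrow> 'a \<Rightarrow> complex) \<Rightarrow> (nat \<Rightarrow> real) \<Rightarrow> (nat \<Rightarrow> nat) \<Rightarrow> (nat \<Rightarrow> nat \<Rightarrow> 'a) \<Rightarrow>
   (nat \<Rightarrow> nat \<Rightarrow> real) \<Rightarrow> (nat \<Rightarrow> real) \<Rightarrow> real \<Rightarrow> real \<Rightarrow> bool" where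
  "marcinkiewicz_zygmund \<mu> \<phi> lam L node \<tau> r A B \<longleftrightarrow>
     (\<forall>m. \<forall>j\<in>{1..L m}. \<tau> m j > 0) \<and>
     (\<forall>m. r m \<ge> 0) \<and> strict_mono r \<and> filterlim r at_top sequentially \<and>
     A > 0 \<and> B > 0 \<and>
     (\<forall>m. \<forall>q\<in>diffusion_poly \<phi> lam (r m).
        A * (L2_norm \<mu> q)\<^sup>2 \<le> (\<Sum>j=1..L m. (cmod (q (node m j)))\<^sup>2 * \<tau> m j) \<and>
        (\<Sum>j=1..L m. (cmod (q (node m j)))\<^sup>2 * \<tau> m j) \<le> B * (L2_norm \<mu> q)\<^sup>2)"

text \<open>
  Together with the Banach space structure given by the type class, \<open>smul\<close> turns \<open>'x\<close> into a
  complex Banach space.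
\<close>

definition complex_scaling :: "(complex \<Rightarrow> 'x::real_normed_vector \<Rightarrow> 'x) \<Rightarrow> bool" where
  "complex_scaling smul \<longleftrightarrow>
     vector_space smul \<and>
     (\<forall>a x. smul (of_real a) x = a *\<^sub>R x) \<and>
     (\<forall>c x. norm (smul c x) = cmod c * norm x)"

definition approximating_subspaces ::
  "(complex \<Rightarrow> 'x::real_normed_vector \<Rightarrow> 'x) \<Rightarrow> (nat \<Rightarrow> 'x set) \<Rightarrow> bool" where
  "approximating_subspaces smul G \<longleftrightarrow>
     (\<forall>m. module.subspace smul (G m) \<and> (\<exists>T. finite T \<and> module.span smul T = G m)) \<and>
     (\<forall>m. G m \<subseteq> G (Suc m)) \<and>
     closure (\<Union>m. G m) = UNIV"

text \<open>
  \<open>F f\<close> is a representative of the image of \<open>f\<close>, so additivity and homogeneity hold almost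
  everywhere. For \<open>p \<in> G m\<close> the representative \<open>F p\<close> is the unique one that lies in the span of
  the continuous functions \<open>\<phi> k\<close>; this is the function whose point values are taken.
\<close>

definition admissible_operator ::
  "'a measure \<Rightarrow> (nat \<Rightarrow> 'a \<Rightarrow> complex) \<Rightarrow> (nat \<Rightarrow> real) \<Rightarrow> (nat \<Rightarrow> real) \<Rightarrow> real \<Rightarrow>
   (complex \<Rightarrow> 'x::real_normed_vector \<Rightarrow> 'x) \<Rightarrow> (nat \<Rightarrow> 'x set) \<Rightarrow> ('x \<Rightarrow> 'a \<Rightarrow> complex) \<Rightarrow> bool" where
  "admissible_operator \<mu> \<phi> lam r \<sigma> smul G F \<longleftrightarrow>
     (\<forall>f. F f \<in> sobolev_space \<mu> \<phi> lam \<sigma>) \<and>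
     (\<forall>f g. AE t in \<mu>. F (f + g) t = F f t + F g t) \<and>
     (\<forall>c f. AE t in \<mu>. F (smul c f) t = c * F f t) \<and>
     (\<exists>C. \<forall>f. sobolev_norm \<mu> \<phi> lam \<sigma> (F f) \<le> ennreal (C * norm f)) \<and>
     (\<forall>m. F ` G m \<subseteq> diffusion_poly \<phi> lam (r m)) \<and>
     (\<lambda>_. 1) \<in> F ` G 0 \<and>
     L2_infinite_dim \<mu> (range F)"

text \<open>
  \<open>\<psi>, \<Lambda>\<close> is a possible outcome of the successive completions: \<open>\<psi> 0, \<dots>, \<psi> (d m)\<close> is an
  orthonormal basis of \<open>F ` G m\<close>, for each \<open>m\<close>.
\<close>

definition adapted_system ::
  "'a measure \<Rightarrow> (nat \<Rightarrow> real) \<Rightarrow> (nat \<Rightarrow> 'x set) \<Rightarrow> ('x \<Rightarrow> 'a \<Rightarrow> complex) \<Rightarrow>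
   (nat \<Rightarrow> nat) \<Rightarrow> (nat \<Rightarrow> 'a \<Rightarrow> complex) \<Rightarrow> (nat \<Rightarrow> real) \<Rightarrow> bool" where
  "adapted_system \<mu> r G F d \<psi> \<Lambda> \<longleftrightarrow>
     \<psi> 0 = (\<lambda>_. 1) \<and> incseq d \<and>
     (\<forall>m. L2_orthonormal \<mu> {..d m} \<psi> \<and> cfun_span (\<psi> ` {..d m}) = F ` G m) \<and>
     (\<forall>k\<le>d 0. \<Lambda> k = r 0) \<and>
     (\<forall>m. \<forall>k\<in>{d m + 1..d (Suc m)}. \<Lambda> k = r (Suc m))"

end

theory Submission
  imports Defs
begin

text \<open>
  Write \<open>g = F f\<close>, \<open>c\<^sub>k\<close> for its coefficients in the adapted system and \<open>P\<close> for the orthogonal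
  projection onto \<open>F ` G m\<close>. If the right-hand side is finite, Cauchy--Schwarz makes
  \<open>\<Sum>k. c\<^sub>k \<psi>\<^sub>k\<close> converge uniformly; its sum is a continuous version \<open>u\<close> of \<open>g\<close>, and \<open>u - P g\<close>
  is bounded pointwise by \<open>E (1 + r\<^sub>m\<^sup>2)\<close> to the power \<open>-\<zeta>/2\<close>, where \<open>E\<close> is the product of the
  Sobolev norm and the tail supremum. Since \<open>F p\<close> is the discrete least-squares projection of the
  data, \<open>P g - F p\<close> is the discrete projection of \<open>P g - y\<close>, so the Marcinkiewicz--Zygmund
  inequality turns this pointwise bound into a bound for \<open>\<parallel>P g - F p\<parallel>\<^sub>2\<close>. The remaining part
  \<open>g - P g\<close> has norm at most \<open>E\<close>, because integrating the tail sum over the probability space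
  bounds each of its weights. The two parts are orthogonal, whence the constant.
\<close>

section \<open>Square-integrable functions and orthonormal systems\<close>

lemma L2_space_measurable: "f \<in> L2_space \<mu> \<Longrightarrow> f \<in> borel_measurable \<mu>"
  by (simp add: L2_space_def)

lemma L2_space_integrable: "f \<in> L2_space \<mu> \<Longrightarrow> integrable \<mu> (\<lambda>x. (cmod (f x))\<^sup>2)"
  by (simp add: L2_space_def)

lemma borel_measurable_cnj [measurable (raw)]:
  "f \<in> borel_measurable \<mu> \<Longrightarrow> (\<lambda>x. cnj (f x)) \<in> borel_measurable \<mu>"
  by (rule borel_measurable_continuous_on[of cnj]) (auto intro: continuous_intros)

lemma L2_integrable_mult_cnj:
  assumes "f \<in> L2_space \<mu>" "g \<in> L2_space \<mu>"
  shows "integrable \<mu> (\<lambda>x. f x * cnj (g x))"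
proof (rule Bochner_Integration.integrable_bound)
  show "integrable \<mu> (\<lambda>x. (cmod (f x))\<^sup>2 + (cmod (g x))\<^sup>2)"
    using assms by (simp add: L2_space_integrable)
  show "(\<lambda>x. f x * cnj (g x)) \<in> borel_measurable \<mu>"
    using assms[THEN L2_space_measurable] by measurable
  have "cmod (f x) * cmod (g x) \<le> (cmod (f x))\<^sup>2 + (cmod (g x))\<^sup>2" for x
    using sum_squares_bound[of "cmod (f x)" "cmod (g x)"]
      mult_nonneg_nonneg[OF norm_ge_zero[of "f x"] norm_ge_zero[of "g x"]] by linarith
  then show "AE x in \<mu>. norm (f x * cnj (g x)) \<le> norm ((cmod (f x))\<^sup>2 + (cmod (g x))\<^sup>2)"
    by (auto simp: norm_mult intro!: AE_I2 order_trans[OF _ abs_ge_self])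
qed

lemma L2_space_scale: "f \<in> L2_space \<mu> \<Longrightarrow> (\<lambda>x. c * f x) \<in> L2_space \<mu>"
  by (auto simp: L2_space_def norm_mult power_mult_distrib)

lemma cmod_add_power2_le: "(cmod (z + w))\<^sup>2 \<le> 2 * (cmod z)\<^sup>2 + 2 * (cmod w)\<^sup>2"
proof -
  have "(cmod (z + w))\<^sup>2 \<le> (cmod z + cmod w)\<^sup>2"
    by (intro power_mono norm_triangle_ineq) simp
  also have "\<dots> \<le> 2 * (cmod z)\<^sup>2 + 2 * (cmod w)\<^sup>2"
    using sum_squares_bound[of "cmod z" "cmod w"] by (simp add: power2_sum)
  finally show ?thesis .
qed

lemma L2_space_add:
  assumes "f \<in> L2_space \<mu>" "g \<in> L2_space \<mu>"
  shows "(\<lambda>x. f x + g x) \<in> L2_space \<mu>"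
proof -
  have [measurable]: "f \<in> borel_measurable \<mu>" "g \<in> borel_measurable \<mu>"
    using assms[THEN L2_space_measurable] .
  have "integrable \<mu> (\<lambda>x. (cmod (f x + g x))\<^sup>2)"
  proof (rule Bochner_Integration.integrable_bound)
    show "integrable \<mu> (\<lambda>x. 2 * (cmod (f x))\<^sup>2 + 2 * (cmod (g x))\<^sup>2)"
      using assms by (simp add: L2_space_integrable)
    show "AE x in \<mu>. norm ((cmod (f x + g x))\<^sup>2) \<le> norm (2 * (cmod (f x))\<^sup>2 + 2 * (cmod (g x))\<^sup>2)"
      using cmod_add_power2_le by (auto intro!: AE_I2 order_trans[OF _ abs_ge_self])
  qed measurable
  then show ?thesis
    by (simp add: L2_space_def)
qed

lemma L2_space_diff:
  "f \<in> L2_space \<mu> \<Longrightarrow> g \<in> L2_space \<mu> \<Longrightarrow> (\<lambda>x. f x - g x) \<in> L2_space \<mu>"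
  using L2_space_add[OF _ L2_space_scale[of g \<mu> "-1"], of f] by simp

lemma L2_space_sum:
  "(\<And>i. i \<in> I \<Longrightarrow> f i \<in> L2_space \<mu>) \<Longrightarrow> (\<lambda>x. \<Sum>i\<in>I. f i x) \<in> L2_space \<mu>"
proof (induction I rule: infinite_finite_induct)
  case (insert i I)
  then show ?case
    by (auto intro: L2_space_add)
qed (simp_all add: L2_space_def)

section \<open>Inner products, norms and finite orthonormal expansions\<close>

lemma L2_inner_diff_left:
  assumes "f \<in> L2_space \<mu>" "g \<in> L2_space \<mu>" "h \<in> L2_space \<mu>"
  shows "L2_inner \<mu> (\<lambda>x. f x - g x) h = L2_inner \<mu> f h - L2_inner \<mu> g h"
  using assms by (simp add: L2_inner_def left_diff_distrib L2_integrable_mult_cnj)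

lemma L2_inner_commute: "L2_inner \<mu> g f = cnj (L2_inner \<mu> f g)"
  using Bochner_Integration.integral_cnj[of \<mu> "\<lambda>x. f x * cnj (g x)"] by (simp add: L2_inner_def mult.commute)

lemma L2_inner_sum_left:
  assumes "\<And>i. i \<in> I \<Longrightarrow> f i \<in> L2_space \<mu>" "h \<in> L2_space \<mu>"
  shows "L2_inner \<mu> (\<lambda>x. \<Sum>i\<in>I. a i * f i x) h = (\<Sum>i\<in>I. a i * L2_inner \<mu> (f i) h)"
proof -
  have "L2_inner \<mu> (\<lambda>x. \<Sum>i\<in>I. a i * f i x) h = (\<integral>x. (\<Sum>i\<in>I. a i * (f i x * cnj (h x))) \<partial>\<mu>)"
    by (simp add: L2_inner_def sum_distrib_right mult.assoc)
  also have "\<dots> = (\<Sum>i\<in>I. a i * L2_inner \<mu> (f i) h)"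
    using assms by (subst Bochner_Integration.integral_sum)
      (auto simp: L2_inner_def L2_integrable_mult_cnj)
  finally show ?thesis .
qed

lemma L2_norm_power2: "(L2_norm \<mu> f)\<^sup>2 = (\<integral>x. (cmod (f x))\<^sup>2 \<partial>\<mu>)"
  by (simp add: L2_norm_def)

lemma L2_norm_nonneg: "0 \<le> L2_norm \<mu> f"
  by (simp add: L2_norm_def)

lemma L2_norm_cong_AE:
  assumes "AE x in \<mu>. f x = g x" "f \<in> borel_measurable \<mu>" "g \<in> borel_measurable \<mu>"
  shows "L2_norm \<mu> f = L2_norm \<mu> g"
  unfolding L2_norm_def using assms by (intro arg_cong[of _ _ sqrt] integral_cong_AE) auto

lemma L2_inner_self: "L2_inner \<mu> f f = complex_of_real ((L2_norm \<mu> f)\<^sup>2)"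
  unfolding L2_inner_def L2_norm_power2 integral_complex_of_real[symmetric]
  by (simp add: complex_norm_square del: of_real_power)

lemma L2_orthonormal_unit:
  assumes "L2_orthonormal \<mu> I \<psi>" "k \<in> I"
  shows "\<psi> k \<in> L2_space \<mu>" "L2_norm \<mu> (\<psi> k) = 1"
proof -
  show "\<psi> k \<in> L2_space \<mu>"
    using assms by (simp add: L2_orthonormal_def)
  have "complex_of_real ((L2_norm \<mu> (\<psi> k))\<^sup>2) = 1"
    using assms unfolding L2_inner_self[symmetric] by (simp add: L2_orthonormal_def)
  then have "(L2_norm \<mu> (\<psi> k))\<^sup>2 = 1"
    by (simp only: of_real_eq_1_iff)
  then show "L2_norm \<mu> (\<psi> k) = 1"
    using L2_norm_nonneg[of \<mu> "\<psi> k"] by (auto simp: power2_eq_1_iff)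
qed

lemma L2_orthonormal_subset: "L2_orthonormal \<mu> J \<psi> \<Longrightarrow> I \<subseteq> J \<Longrightarrow> L2_orthonormal \<mu> I \<psi>"
  unfolding L2_orthonormal_def by blast

lemma L2_inner_sum_orthonormal:
  assumes "finite I" "L2_orthonormal \<mu> I \<psi>" "k \<in> I"
  shows "L2_inner \<mu> (\<lambda>x. \<Sum>i\<in>I. a i * \<psi> i x) (\<psi> k) = a k"
  using assms by (subst L2_inner_sum_left)
    (auto simp: L2_orthonormal_def if_distrib[of "\<lambda>z. _ * z"] cong: if_cong)

lemma L2_norm_diff_power2:
  assumes "f \<in> L2_space \<mu>" "g \<in> L2_space \<mu>"
  shows "(L2_norm \<mu> (\<lambda>x. f x - g x))\<^sup>2
       = (L2_norm \<mu> f)\<^sup>2 - 2 * Re (L2_inner \<mu> g f) + (L2_norm \<mu> g)\<^sup>2"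
proof -
  let ?h = "\<lambda>x. f x - g x"
  have h: "?h \<in> L2_space \<mu>"
    using assms by (rule L2_space_diff)
  have "complex_of_real ((L2_norm \<mu> ?h)\<^sup>2) = L2_inner \<mu> f ?h - L2_inner \<mu> g ?h"
    using L2_inner_diff_left[OF assms h] by (simp only: L2_inner_self)
  also have "\<dots> = cnj (L2_inner \<mu> ?h f) - cnj (L2_inner \<mu> ?h g)"
    by (simp only: L2_inner_commute[of \<mu> _ ?h])
  also have "\<dots> = cnj (L2_inner \<mu> f f - L2_inner \<mu> g f) - cnj (L2_inner \<mu> f g - L2_inner \<mu> g g)"
    using assms by (simp only: L2_inner_diff_left)
  finally have "Re (complex_of_real ((L2_norm \<mu> ?h)\<^sup>2)) = Re \<dots>"
    by (rule arg_cong)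
  then show ?thesis
    by (simp add: L2_inner_self L2_inner_commute[of \<mu> f g])
qed

text \<open>Completing the square in each coefficient. Only the last sum depends on
  \<open>a\<close>, and it vanishes for the Fourier coefficients, so this identity yields best
  approximation as well as Parseval's identity for finite sums.\<close>

lemma L2_norm_diff_orthonormal_sum:
  assumes "finite I" and ON: "L2_orthonormal \<mu> I \<psi>" and f: "f \<in> L2_space \<mu>"
  shows "(L2_norm \<mu> (\<lambda>x. f x - (\<Sum>k\<in>I. a k * \<psi> k x)))\<^sup>2
       = (L2_norm \<mu> f)\<^sup>2 - (\<Sum>k\<in>I. (cmod (L2_inner \<mu> f (\<psi> k)))\<^sup>2)
         + (\<Sum>k\<in>I. (cmod (L2_inner \<mu> f (\<psi> k) - a k))\<^sup>2)"
proof -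
  let ?s = "\<lambda>x. \<Sum>k\<in>I. a k * \<psi> k x" and ?c = "\<lambda>k. L2_inner \<mu> f (\<psi> k)"
  have psi: "\<psi> k \<in> L2_space \<mu>" if "k \<in> I" for k
    using ON that by (simp add: L2_orthonormal_def)
  have s: "?s \<in> L2_space \<mu>"
    by (intro L2_space_sum L2_space_scale psi)
  have "L2_inner \<mu> ?s ?s = (\<Sum>k\<in>I. a k * cnj (a k))"
    using assms psi s
    by (subst L2_inner_sum_left)
      (auto intro!: sum.cong simp: L2_inner_commute[of \<mu> "\<psi> _" ?s] L2_inner_sum_orthonormal)
  also have "\<dots> = complex_of_real (\<Sum>k\<in>I. (cmod (a k))\<^sup>2)"
    by (simp add: complex_norm_square del: of_real_power)
  finally have ss: "(L2_norm \<mu> ?s)\<^sup>2 = (\<Sum>k\<in>I. (cmod (a k))\<^sup>2)"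
    unfolding L2_inner_self of_real_eq_iff .
  have sf: "L2_inner \<mu> ?s f = (\<Sum>k\<in>I. a k * cnj (?c k))"
    using psi f by (subst L2_inner_sum_left) (auto simp: L2_inner_commute[of \<mu> "\<psi> _" f])
  have "(cmod (z - w))\<^sup>2 = (cmod z)\<^sup>2 - 2 * Re (w * cnj z) + (cmod w)\<^sup>2" for z w :: complex
    by (simp add: cmod_power2) (simp add: power2_eq_square algebra_simps)
  then show ?thesis
    unfolding L2_norm_diff_power2[OF f s] ss sf
    by (simp add: sum.distrib sum_subtractf sum_distrib_left)
qed

lemma L2_norm_orthonormal_sum:
  assumes "finite I" "L2_orthonormal \<mu> I \<psi>"
  shows "(L2_norm \<mu> (\<lambda>x. \<Sum>k\<in>I. a k * \<psi> k x))\<^sup>2 = (\<Sum>k\<in>I. (cmod (a k))\<^sup>2)"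
  \<comment> \<open>For the zero function only the last sum survives, with entries
    \<open>cmod (0 - a k)\<close>.\<close>
  using L2_norm_diff_orthonormal_sum[OF assms, of "\<lambda>_. 0" a]
  by (simp add: L2_space_def L2_inner_def L2_norm_def sum_nonneg)

lemma AE_eq_of_L2_norm_diff_eq_0:
  assumes "f \<in> L2_space \<mu>" "g \<in> L2_space \<mu>" "L2_norm \<mu> (\<lambda>x. f x - g x) = 0"
  shows "AE x in \<mu>. f x = g x"
proof -
  have "integrable \<mu> (\<lambda>x. (cmod (f x - g x))\<^sup>2)"
    using assms by (intro L2_space_integrable L2_space_diff)
  moreover have "(\<integral>x. (cmod (f x - g x))\<^sup>2 \<partial>\<mu>) = 0"
    using assms(3) by (simp add: L2_norm_def)
  ultimately have "AE x in \<mu>. (cmod (f x - g x))\<^sup>2 = 0"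
    by (subst (asm) integral_nonneg_eq_0_iff_AE) auto
  then show ?thesis
    by simp
qed

section \<open>Finite linear combinations of an indexed family and best approximation\<close>

lemma cfun_span_image_obtain:
  assumes "v \<in> cfun_span (\<psi> ` I)"
  obtains J a where "finite J" "J \<subseteq> I" "v = (\<lambda>x. \<Sum>k\<in>J. a k * \<psi> k x)"
proof -
  have "\<exists>J a. finite J \<and> J \<subseteq> I \<and> v = (\<lambda>x. \<Sum>k\<in>J. a k * \<psi> k x)"
    using assms
  proof (induction rule: cfun.span_induct_alt)
    case base
    show ?case
      by (intro exI[of _ "{}"]) (auto simp: fun_eq_iff)
  next
    case (step c w z)
    then obtain i J a where i: "i \<in> I" "w = \<psi> i"
      and J: "finite J" "J \<subseteq> I" "z = (\<lambda>x. \<Sum>k\<in>J. a k * \<psi> k x)" by blast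
    \<comment> \<open>Coefficients are attached to indices, and \<open>i\<close> may already occur
      in \<open>J\<close>; the new coefficient is therefore added to the old one.\<close>
    define b where "b k = (if k = i then c else 0) + (if k \<in> J then a k else 0)" for k
    have "(\<Sum>k\<in>insert i J. b k * \<psi> k x) = c * \<psi> i x + (\<Sum>k\<in>J. a k * \<psi> k x)" for x
    proof -
      have "(\<Sum>k\<in>insert i J. b k * \<psi> k x)
        = (\<Sum>k\<in>insert i J. if k = i then c * \<psi> i x else 0) + (\<Sum>k\<in>insert i J. if k \<in> J then a k * \<psi> k x else 0)"
        by (auto simp: b_def sum.distrib[symmetric] algebra_simps intro!: sum.cong)
      also have "(\<Sum>k\<in>insert i J. if k \<in> J then a k * \<psi> k x else 0) = (\<Sum>k\<in>J. a k * \<psi> k x)"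
        using J(1) by (intro sum.mono_neutral_cong_right) auto
      finally show ?thesis
        using J(1) by simp
    qed
    then show ?case
      using i J by (intro exI[of _ "insert i J"] exI[of _ b]) (auto simp: fun_eq_iff)
  qed
  with that show thesis by blast
qed

lemma cfun_span_finite_image:
  assumes "finite I"
  shows "cfun_span (\<psi> ` I) = {v. \<exists>a. v = (\<lambda>x. \<Sum>k\<in>I. a k * \<psi> k x)}"
proof (intro set_eqI iffI; clarify?)
  fix v assume "v \<in> cfun_span (\<psi> ` I)"
  then obtain J a where J: "finite J" "J \<subseteq> I" "v = (\<lambda>x. \<Sum>k\<in>J. a k * \<psi> k x)"
    by (rule cfun_span_image_obtain)
  have "(\<Sum>k\<in>J. a k * \<psi> k x) = (\<Sum>k\<in>I. (if k \<in> J then a k else 0) * \<psi> k x)" for x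
    using J assms by (intro sum.mono_neutral_cong_left) auto
  then show "\<exists>a. v = (\<lambda>x. \<Sum>k\<in>I. a k * \<psi> k x)"
    using J(3) by auto
next
  fix a
  have "(\<Sum>k\<in>I. (\<lambda>x. a k * \<psi> k x)) \<in> cfun_span (\<psi> ` I)"
    by (intro cfun.span_sum cfun.span_scale cfun.span_base) auto
  moreover have "(\<Sum>k\<in>I. (\<lambda>x. a k * \<psi> k x)) = (\<lambda>x. \<Sum>k\<in>I. a k * \<psi> k x)"
    by (induction I rule: infinite_finite_induct) (auto simp: fun_eq_iff)
  ultimately show "(\<lambda>x. \<Sum>k\<in>I. a k * \<psi> k x) \<in> cfun_span (\<psi> ` I)"
    by simp
qed

lemma cfun_span_subset_L2_space:
  assumes "L2_orthonormal \<mu> I \<psi>"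
  shows "cfun_span (\<psi> ` I) \<subseteq> L2_space \<mu>"
proof
  fix v assume "v \<in> cfun_span (\<psi> ` I)"
  then obtain J a where "J \<subseteq> I" "v = (\<lambda>x. \<Sum>k\<in>J. a k * \<psi> k x)"
    by (rule cfun_span_image_obtain)
  then show "v \<in> L2_space \<mu>"
    using assms by (auto simp: L2_orthonormal_def intro!: L2_space_sum L2_space_scale)
qed

lemma cfun_span_range_obtain:
  fixes \<psi> :: "nat \<Rightarrow> 'a \<Rightarrow> complex"
  assumes "v \<in> cfun_span (range \<psi>)"
  obtains n where "v \<in> cfun_span (\<psi> ` {..n})"
proof -
  obtain J a where J: "finite J" "v = (\<lambda>x. \<Sum>k\<in>J. a k * \<psi> k x)"
    using assms by (rule cfun_span_image_obtain)
  have "v \<in> cfun_span (\<psi> ` J)"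
    using J by (auto simp: cfun_span_finite_image)
  moreover obtain n where "J \<subseteq> {..n}"
    using J(1) finite_nat_set_iff_bounded_le by auto
  ultimately show thesis
    using that cfun.span_mono[of "\<psi> ` J" "\<psi> ` {..n}"] by blast
qed

lemma L2_norm_projection_le:
  assumes "finite I" "L2_orthonormal \<mu> I \<psi>" "f \<in> L2_space \<mu>" "v \<in> cfun_span (\<psi> ` I)"
  shows "L2_norm \<mu> (\<lambda>x. f x - (\<Sum>k\<in>I. L2_inner \<mu> f (\<psi> k) * \<psi> k x)) \<le> L2_norm \<mu> (\<lambda>x. f x - v x)"
proof -
  obtain a where "v = (\<lambda>x. \<Sum>k\<in>I. a k * \<psi> k x)"
    using assms(1,4) by (auto simp: cfun_span_finite_image)
  then have "(L2_norm \<mu> (\<lambda>x. f x - (\<Sum>k\<in>I. L2_inner \<mu> f (\<psi> k) * \<psi> k x)))\<^sup>2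
      \<le> (L2_norm \<mu> (\<lambda>x. f x - v x))\<^sup>2"
    by (simp add: L2_norm_diff_orthonormal_sum[OF assms(1-3)] sum_nonneg)
  then show ?thesis
    by (rule power2_le_imp_le) (rule L2_norm_nonneg)
qed

section \<open>Sobolev norms\<close>

lemma ennreal_sqrt_le_iff:
  assumes "0 \<le> R"
  shows "ennreal_sqrt t \<le> ennreal R \<longleftrightarrow> t \<le> ennreal (R\<^sup>2)"
proof (cases t)
  case (real t')
  then show ?thesis
    using assms real_sqrt_le_iff[of t' "R\<^sup>2"] by (simp add: ennreal_sqrt_def)
qed (simp add: ennreal_sqrt_def top_unique)

text \<open>A series of nonnegative terms is the supremum of its partial sums. Through this
  equivalence the Sobolev norm and the tail supremum turn into families of bounds for finite real
  sums.\<close>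

lemma suminf_ennreal_le_iff:
  assumes "\<And>k. 0 \<le> f k" "0 \<le> M"
  shows "(\<Sum>k. ennreal (f k)) \<le> ennreal M \<longleftrightarrow> (\<forall>n. (\<Sum>k<n. f k) \<le> M)"
  using assms by (simp add: suminf_eq_SUP SUP_le_iff sum_ennreal)

lemma sobolev_norm_le_iff:
  assumes "0 \<le> R"
  shows "sobolev_norm \<mu> \<psi> \<Lambda> s f \<le> ennreal R \<longleftrightarrow>
    (\<forall>n. (\<Sum>k<n. (cmod (L2_inner \<mu> f (\<psi> k)))\<^sup>2 * (1 + (\<Lambda> k)\<^sup>2) powr s) \<le> R\<^sup>2)"
  unfolding sobolev_norm_def ennreal_sqrt_le_iff[OF assms]
  by (rule suminf_ennreal_le_iff) simp_all

lemma tail_sup_le_iff: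
  assumes "0 \<le> R"
  shows "tail_sup \<psi> \<Lambda> s r \<le> ennreal R \<longleftrightarrow>
    (\<forall>x n. (\<Sum>k | k < n \<and> \<Lambda> k > r. (cmod (\<psi> k x))\<^sup>2 * (1 + (\<Lambda> k)\<^sup>2) powr (- s)) \<le> R\<^sup>2)"
proof -
  have "ennreal_sqrt (\<Sum>k. if \<Lambda> k > r then ennreal ((cmod (\<psi> k x))\<^sup>2 * (1 + (\<Lambda> k)\<^sup>2) powr (- s)) else 0)
        \<le> ennreal R \<longleftrightarrow>
    (\<forall>n. (\<Sum>k | k < n \<and> \<Lambda> k > r. (cmod (\<psi> k x))\<^sup>2 * (1 + (\<Lambda> k)\<^sup>2) powr (- s)) \<le> R\<^sup>2)" for x
  proof -
    let ?h = "\<lambda>k. if \<Lambda> k > r then (cmod (\<psi> k x))\<^sup>2 * (1 + (\<Lambda> k)\<^sup>2) powr (- s) else 0"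
    have "(\<lambda>k. if \<Lambda> k > r then ennreal ((cmod (\<psi> k x))\<^sup>2 * (1 + (\<Lambda> k)\<^sup>2) powr (- s)) else 0)
      = (\<lambda>k. ennreal (?h k))"
      by auto
    moreover have "(\<Sum>k<n. ?h k)
      = (\<Sum>k | k < n \<and> \<Lambda> k > r. (cmod (\<psi> k x))\<^sup>2 * (1 + (\<Lambda> k)\<^sup>2) powr (- s))" for n
      by (subst sum.inter_filter[symmetric]) (auto intro: sum.cong)
    ultimately show ?thesis
      by (simp only: ennreal_sqrt_le_iff[OF assms]) (subst suminf_ennreal_le_iff; simp)
  qed
  then show ?thesis
    unfolding tail_sup_def by (simp add: SUP_le_iff)
qed

text \<open>Any approximant of \<open>f\<close> lies in the span of finitely many
  \<open>\<psi> k\<close>, and from that index on the partial Fourier sum is at least as close to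
  \<open>f\<close>.\<close>

lemma L2_norm_orthonormal_series_tendsto:
  fixes \<psi> :: "nat \<Rightarrow> 'a \<Rightarrow> complex"
  assumes ON: "L2_orthonormal \<mu> UNIV \<psi>" and f: "f \<in> L2_closure \<mu> (cfun_span (range \<psi>))"
  shows "(\<lambda>n. L2_norm \<mu> (\<lambda>x. f x - (\<Sum>k\<le>n. L2_inner \<mu> f (\<psi> k) * \<psi> k x))) \<longlonglongrightarrow> 0"
proof (rule LIMSEQ_I)
  fix e :: real assume "0 < e"
  then obtain v where v: "v \<in> cfun_span (range \<psi>)" "L2_norm \<mu> (\<lambda>x. f x - v x) < e"
    using f by (auto simp: L2_closure_def)
  obtain N where N: "v \<in> cfun_span (\<psi> ` {..N})"
    using v(1) by (rule cfun_span_range_obtain)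
  have "L2_norm \<mu> (\<lambda>x. f x - (\<Sum>k\<le>n. L2_inner \<mu> f (\<psi> k) * \<psi> k x)) < e" if "N \<le> n" for n
  proof -
    have "v \<in> cfun_span (\<psi> ` {..n})"
      by (rule subsetD[OF cfun.span_mono[OF image_mono] N]) (use that in simp)
    then have "L2_norm \<mu> (\<lambda>x. f x - (\<Sum>k\<le>n. L2_inner \<mu> f (\<psi> k) * \<psi> k x)) \<le> L2_norm \<mu> (\<lambda>x. f x - v x)"
      using f by (intro L2_norm_projection_le L2_orthonormal_subset[OF ON]) (auto simp: L2_closure_def)
    with v(2) show ?thesis by simp
  qed
  then show "\<exists>N. \<forall>n\<ge>N. norm (L2_norm \<mu> (\<lambda>x. f x - (\<Sum>k\<le>n. L2_inner \<mu> f (\<psi> k) * \<psi> k x)) - 0) < e"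
    by (auto simp: L2_norm_nonneg)
qed

text \<open>For nonnegative \<open>s\<close> all weights are at least 1, so the Sobolev norm
  dominates the square sum of the coefficients. Membership in the closure makes that sum exhaust the
  norm of \<open>f\<close>.\<close>

lemma L2_norm_le_sobolev_norm:
  assumes ON: "L2_orthonormal \<mu> UNIV \<psi>" and f: "f \<in> L2_closure \<mu> (cfun_span (range \<psi>))"
    and "0 \<le> s" "0 \<le> R" and R: "sobolev_norm \<mu> \<psi> \<Lambda> s f \<le> ennreal R"
  shows "L2_norm \<mu> f \<le> R"
proof -
  let ?c = "\<lambda>k. L2_inner \<mu> f (\<psi> k)"
  let ?e = "\<lambda>n. L2_norm \<mu> (\<lambda>x. f x - (\<Sum>k\<le>n. ?c k * \<psi> k x))"
  have "(L2_norm \<mu> f)\<^sup>2 \<le> R\<^sup>2 + (?e n)\<^sup>2" for n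
  proof -
    have "(L2_norm \<mu> f)\<^sup>2 = (\<Sum>k\<le>n. (cmod (?c k))\<^sup>2) + (?e n)\<^sup>2"
      using L2_norm_diff_orthonormal_sum[OF _ L2_orthonormal_subset[OF ON], of "{..n}" f ?c] f
      by (simp add: L2_closure_def)
    also have "(\<Sum>k\<le>n. (cmod (?c k))\<^sup>2) \<le> (\<Sum>k<Suc n. (cmod (?c k))\<^sup>2 * (1 + (\<Lambda> k)\<^sup>2) powr s)"
      unfolding lessThan_Suc_atMost
    proof (rule sum_mono)
      fix k
      have "1 \<le> (1 + (\<Lambda> k)\<^sup>2) powr s"
        using \<open>0 \<le> s\<close> by (intro ge_one_powr_ge_zero) auto
      then show "(cmod (?c k))\<^sup>2 \<le> (cmod (?c k))\<^sup>2 * (1 + (\<Lambda> k)\<^sup>2) powr s"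
        using mult_left_mono[of 1 _ "(cmod (?c k))\<^sup>2"] by simp
    qed
    also have "\<dots> \<le> R\<^sup>2"
      using R \<open>0 \<le> R\<close> by (simp only: sobolev_norm_le_iff)
    finally show ?thesis by simp
  qed
  moreover have "(\<lambda>n. R\<^sup>2 + (?e n)\<^sup>2) \<longlonglongrightarrow> R\<^sup>2 + 0\<^sup>2"
    by (intro tendsto_intros L2_norm_orthonormal_series_tendsto[OF ON f])
  ultimately have "(L2_norm \<mu> f)\<^sup>2 \<le> R\<^sup>2 + 0\<^sup>2"
    by (intro LIMSEQ_le_const) auto
  then show ?thesis
    using \<open>0 \<le> R\<close> power2_le_imp_le by auto
qed

text \<open>Keep one summand of the pointwise tail bound and integrate: \<open>\<psi> k\<close> has
  mean square 1, and a constant integrates to itself over a probability space.\<close>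

lemma tail_sup_term_le:
  assumes "prob_space \<mu>" and psi: "\<psi> k \<in> L2_space \<mu>" "L2_norm \<mu> (\<psi> k) = 1"
    and k: "r < \<Lambda> k" and H: "tail_sup \<psi> \<Lambda> s r \<le> ennreal H" "0 \<le> H"
  shows "(1 + (\<Lambda> k)\<^sup>2) powr (- s) \<le> H\<^sup>2"
proof -
  interpret prob_space \<mu> by fact
  let ?v = "\<lambda>k. (1 + (\<Lambda> k)\<^sup>2) powr (- s)"
  have "(cmod (\<psi> k x))\<^sup>2 * ?v k \<le> H\<^sup>2" for x
  proof -
    have "(cmod (\<psi> k x))\<^sup>2 * ?v k \<le> (\<Sum>i | i < Suc k \<and> \<Lambda> i > r. (cmod (\<psi> i x))\<^sup>2 * ?v i)"
      using k by (intro member_le_sum[of k _ "\<lambda>i. (cmod (\<psi> i x))\<^sup>2 * ?v i"]) auto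
    also have "\<dots> \<le> H\<^sup>2"
      using H(1)[unfolded tail_sup_le_iff[OF H(2)]] by blast
    finally show ?thesis .
  qed
  then have "(\<integral>x. (cmod (\<psi> k x))\<^sup>2 * ?v k \<partial>\<mu>) \<le> (\<integral>x. H\<^sup>2 \<partial>\<mu>)"
    using psi(1) by (intro integral_mono integrable_mult_left L2_space_integrable) auto
  moreover have "(\<integral>x. (cmod (\<psi> k x))\<^sup>2 * ?v k \<partial>\<mu>) = (L2_norm \<mu> (\<psi> k))\<^sup>2 * ?v k"
    by (simp add: L2_norm_power2)
  ultimately have "(L2_norm \<mu> (\<psi> k))\<^sup>2 * ?v k \<le> H\<^sup>2"
    by (simp only: lebesgue_integral_const prob_space scaleR_one)
  then show ?thesis
    by (simp only: psi(2) power_one mult_1)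
qed

text \<open>The disjunct \<open>S = 0\<close> in the hypotheses below serves the case of an infinite \<open>tail_sup\<close>, where
  \<open>0 * \<infinity> = 0\<close> on extended reals still makes the claimed bound finite.\<close>

lemma sobolev_tail_le:
  assumes "prob_space \<mu>" and ON: "L2_orthonormal \<mu> UNIV \<psi>"
    and low: "\<And>k. \<Lambda> k \<le> R \<longleftrightarrow> k \<le> D" and "\<zeta> \<le> \<sigma>"
    and S: "sobolev_norm \<mu> \<psi> \<Lambda> \<sigma> g \<le> ennreal S" "0 \<le> S"
    and H: "S = 0 \<or> tail_sup \<psi> \<Lambda> (\<sigma> - \<zeta>) R \<le> ennreal H" "0 \<le> H"
  shows "(\<Sum>k\<in>{D<..n}. (cmod (L2_inner \<mu> g (\<psi> k)))\<^sup>2 * (1 + (\<Lambda> k)\<^sup>2) powr \<zeta>) \<le> (S * H)\<^sup>2"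
proof -
  let ?c = "\<lambda>k. (cmod (L2_inner \<mu> g (\<psi> k)))\<^sup>2" and ?W = "\<lambda>k. 1 + (\<Lambda> k)\<^sup>2"
  have "(\<Sum>k\<in>{D<..n}. ?c k * ?W k powr \<sigma>) \<le> (\<Sum>k<Suc n. ?c k * ?W k powr \<sigma>)"
    by (intro sum_mono2) auto
  also have "\<dots> \<le> S\<^sup>2"
    using S(1) by (simp only: sobolev_norm_le_iff[OF S(2)])
  finally have sum_le: "(\<Sum>k\<in>{D<..n}. ?c k * ?W k powr \<sigma>) \<le> S\<^sup>2" .
  show ?thesis
  proof (cases "S = 0")
    case True
    \<comment> \<open>No tail bound is at hand here. The bases \<open>?W k\<close> are at least 1,
      so the larger exponent \<open>\<sigma>\<close> only increases the sum, which is then at most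
      \<open>S\<^sup>2 = 0\<close>.\<close>
    have "(\<Sum>k\<in>{D<..n}. ?c k * ?W k powr \<zeta>) \<le> (\<Sum>k\<in>{D<..n}. ?c k * ?W k powr \<sigma>)"
      using \<open>\<zeta> \<le> \<sigma>\<close> by (intro sum_mono mult_left_mono powr_mono) auto
    with sum_le True show ?thesis
      by simp
  next
    case False
    have "(\<Sum>k\<in>{D<..n}. ?c k * ?W k powr \<zeta>) \<le> (\<Sum>k\<in>{D<..n}. ?c k * ?W k powr \<sigma> * H\<^sup>2)"
    proof (rule sum_mono)
      fix k assume "k \<in> {D<..n}"
      then have "R < \<Lambda> k"
        using low[of k] by auto
      then have "?W k powr (- (\<sigma> - \<zeta>)) \<le> H\<^sup>2"
        using H False L2_orthonormal_unit[OF ON]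
        by (intro tail_sup_term_le[OF \<open>prob_space \<mu>\<close>]) auto
      \<comment> \<open>The factor by which the two Sobolev weights differ is exactly the weight
        occurring in \<open>tail_sup\<close>.\<close>
      moreover have "?W k powr \<zeta> = ?W k powr \<sigma> * ?W k powr (- (\<sigma> - \<zeta>))"
        by (simp flip: powr_add)
      ultimately show "?c k * ?W k powr \<zeta> \<le> ?c k * ?W k powr \<sigma> * H\<^sup>2"
        by (simp add: mult_left_mono mult.assoc)
    qed
    also have "\<dots> \<le> S\<^sup>2 * H\<^sup>2"
      unfolding sum_distrib_right[symmetric] by (intro mult_right_mono sum_le) simp
    finally show ?thesis
      by (simp add: power_mult_distrib)
  qed
qed

section \<open>Uniform convergence of orthonormal series\<close>

text \<open>Cauchy-Schwarz after inserting \<open>sqrt (w k) * sqrt (v k) = 1\<close> into every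
  term.\<close>

lemma cmod_sum_mult_le_weighted:
  assumes "\<And>k. k \<in> K \<Longrightarrow> 0 \<le> w k" "\<And>k. k \<in> K \<Longrightarrow> w k * v k = 1"
    and T: "(\<Sum>k\<in>K. (cmod (c k))\<^sup>2 * w k) \<le> T\<^sup>2" "0 \<le> T"
    and H: "(\<Sum>k\<in>K. (cmod (z k))\<^sup>2 * v k) \<le> H\<^sup>2" "0 \<le> H"
  shows "cmod (\<Sum>k\<in>K. c k * z k) \<le> T * H"
proof -
  have v: "0 \<le> v k" if "k \<in> K" for k
    using assms(1,2)[OF that] by (metis zero_le_mult_iff zero_le_one zero_neq_one mult_zero_left linorder_not_less order_le_less)
  have "cmod (\<Sum>k\<in>K. c k * z k) \<le> (\<Sum>k\<in>K. cmod (c k * z k))"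
    by (rule norm_sum)
  also have "\<dots> = (\<Sum>k\<in>K. \<bar>cmod (c k) * sqrt (w k)\<bar> * \<bar>cmod (z k) * sqrt (v k)\<bar>)"
  proof (rule sum.cong)
    fix k assume k: "k \<in> K"
    have "sqrt (w k) * sqrt (v k) = 1"
      using assms(2)[OF k] by (metis real_sqrt_mult real_sqrt_one)
    then have "(cmod (c k) * sqrt (w k)) * (cmod (z k) * sqrt (v k)) = cmod (c k * z k)"
      by (metis (no_types, lifting) mult.assoc mult.left_commute mult.right_neutral norm_mult)
    then show "cmod (c k * z k) = \<bar>cmod (c k) * sqrt (w k)\<bar> * \<bar>cmod (z k) * sqrt (v k)\<bar>"
      by (metis abs_mult abs_norm_cancel)
  qed simp
  also have "\<dots> \<le> L2_set (\<lambda>k. cmod (c k) * sqrt (w k)) K * L2_set (\<lambda>k. cmod (z k) * sqrt (v k)) K"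
    by (rule L2_set_mult_ineq)
  also have "\<dots> \<le> T * H"
  proof (intro mult_mono)
    show "L2_set (\<lambda>k. cmod (c k) * sqrt (w k)) K \<le> T"
      unfolding L2_set_def using assms(1) T
      by (intro real_le_lsqrt) (auto simp: power_mult_distrib intro!: sum_nonneg)
    show "L2_set (\<lambda>k. cmod (z k) * sqrt (v k)) K \<le> H"
      unfolding L2_set_def using v H
      by (intro real_le_lsqrt) (auto simp: power_mult_distrib intro!: sum_nonneg)
  qed (use T H in auto)
  finally show ?thesis .
qed

text \<open>In Cauchy-Schwarz the factor from the coefficients is the tail of a convergent series
  and does not depend on \<open>x\<close>; the other factor is at most \<open>H\<close> at every
  point. Hence the partial sums are uniformly Cauchy.\<close>

lemma uniform_limit_weighted_series:
  fixes \<psi> :: "nat \<Rightarrow> 'a \<Rightarrow> complex"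
  assumes w: "\<And>k. 0 \<le> w k" "\<And>k. w k * v k = 1"
    and summable: "summable (\<lambda>k. (cmod (c k))\<^sup>2 * w k)"
    and H: "\<And>x n. (\<Sum>k\<in>{D<..n}. (cmod (\<psi> k x))\<^sup>2 * v k) \<le> H\<^sup>2" "0 \<le> H"
  obtains u where "uniform_limit UNIV (\<lambda>n x. \<Sum>k\<le>n. c k * \<psi> k x) u sequentially"
proof -
  have v: "0 \<le> v k" for k
    using w[of k] by (metis zero_le_mult_iff zero_le_one zero_neq_one mult_zero_left linorder_not_less order_le_less)
  have "uniformly_Cauchy_on UNIV (\<lambda>n x. \<Sum>k\<le>n. c k * \<psi> k x)"
  proof (rule uniformly_Cauchy_onI')
    fix e :: real assume "0 < e"
    \<comment> \<open>The summand 1 keeps the denominator positive when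
      \<open>H = 0\<close>.\<close>
    define T where "T = e / (2 * (H + 1))"
    have T: "0 < T" "T * H < e"
    proof -
      show "0 < T"
        using \<open>0 < e\<close> \<open>0 \<le> H\<close> by (simp add: T_def)
      have "e * H < e * (2 * (H + 1))"
        using \<open>0 < e\<close> \<open>0 \<le> H\<close> by (intro mult_strict_left_mono) auto
      then show "T * H < e"
        using \<open>0 \<le> H\<close> by (simp add: T_def divide_less_eq)
    qed
    obtain N where N: "\<And>m n. N \<le> m \<Longrightarrow> norm (\<Sum>k\<in>{m..<n}. (cmod (c k))\<^sup>2 * w k) < T\<^sup>2"
      using summable \<open>0 < T\<close> unfolding summable_Cauchy by (metis zero_less_power)
    have "dist (\<Sum>k\<le>m. c k * \<psi> k x) (\<Sum>k\<le>n. c k * \<psi> k x) < e"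
      \<comment> \<open>Beyond \<open>N\<close> the coefficient tail is small; beyond
        \<open>D\<close> the bound by \<open>H\<close> applies.\<close>
      if m: "max N D \<le> m" and n: "m < n" for m n x
    proof -
      have "(\<Sum>k\<le>n. c k * \<psi> k x) - (\<Sum>k\<le>m. c k * \<psi> k x) = (\<Sum>k\<in>{..n} - {..m}. c k * \<psi> k x)"
        using n by (intro sum_diff[symmetric]) auto
      also have "{..n} - {..m} = {m<..n}"
        using n by auto
      finally have "dist (\<Sum>k\<le>m. c k * \<psi> k x) (\<Sum>k\<le>n. c k * \<psi> k x)
        = cmod (\<Sum>k\<in>{m<..n}. c k * \<psi> k x)"
        by (subst dist_commute) (simp add: dist_norm)
      also have "\<dots> \<le> T * H"
      proof (rule cmod_sum_mult_le_weighted[where w = w and v = v])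
        show "(\<Sum>k\<in>{m<..n}. (cmod (c k))\<^sup>2 * w k) \<le> T\<^sup>2"
          using N[of "Suc m" "Suc n"] m
          by (simp add: atLeastLessThanSuc_atLeastAtMost atLeastSucAtMost_greaterThanAtMost)
        have "(\<Sum>k\<in>{m<..n}. (cmod (\<psi> k x))\<^sup>2 * v k) \<le> (\<Sum>k\<in>{D<..n}. (cmod (\<psi> k x))\<^sup>2 * v k)"
          using m v by (intro sum_mono2) auto
        with H(1)[where x = x and n = n] show "(\<Sum>k\<in>{m<..n}. (cmod (\<psi> k x))\<^sup>2 * v k) \<le> H\<^sup>2"
          by linarith
      qed (use w T H in auto)
      also have "\<dots> < e"
        by (rule T)
      finally show ?thesis .
    qed
    then show "\<exists>M. \<forall>x\<in>UNIV. \<forall>m\<ge>M. \<forall>n>m.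
        dist (\<Sum>k\<le>m. c k * \<psi> k x) (\<Sum>k\<le>n. c k * \<psi> k x) < e"
      by blast
  qed
  then show thesis
    using that Cauchy_uniformly_convergent uniformly_convergent_on_def by blast
qed

text \<open>On a probability space uniform closeness implies closeness in mean square, so the
  pointwise limit and the limit in norm are the same class. This ties point values to Fourier
  expansions.\<close>

lemma AE_eq_uniform_limit_L2_limit:
  assumes "prob_space \<mu>"
    and S: "\<And>n. S n \<in> L2_space \<mu>" and f: "f \<in> L2_space \<mu>" and u: "u \<in> borel_measurable \<mu>"
    and unif: "uniform_limit UNIV S u sequentially"
    and lim: "(\<lambda>n. L2_norm \<mu> (\<lambda>x. f x - S n x)) \<longlonglongrightarrow> 0"
  shows "AE x in \<mu>. u x = f x"
proof -
  interpret prob_space \<mu> by fact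
  have near: "(\<lambda>x. u x - S n x) \<in> L2_space \<mu> \<and> (L2_norm \<mu> (\<lambda>x. u x - S n x))\<^sup>2 \<le> e\<^sup>2"
    if e: "0 < e" "\<And>x. dist (S n x) (u x) < e" for e n
  proof -
    have *: "(cmod (u x - S n x))\<^sup>2 \<le> e\<^sup>2" for x
      using e(2)[of x] by (intro power_mono) (auto simp: dist_norm norm_minus_commute)
    have int: "integrable \<mu> (\<lambda>x. (cmod (u x - S n x))\<^sup>2)"
    proof (rule integrable_const_bound[of _ "e\<^sup>2"])
      show "(\<lambda>x. (cmod (u x - S n x))\<^sup>2) \<in> borel_measurable \<mu>"
        using u L2_space_measurable[OF S, of n] by measurable
    qed (use * in auto)
    moreover have "(\<integral>x. (cmod (u x - S n x))\<^sup>2 \<partial>\<mu>) \<le> (\<integral>x. e\<^sup>2 \<partial>\<mu>)"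
      using * int by (intro integral_mono) auto
    ultimately show ?thesis
      using u L2_space_measurable[OF S, of n] by (simp add: L2_space_def L2_norm_power2 prob_space)
  qed
  \<comment> \<open>\<open>u\<close> differs by a bounded function from a square-integrable partial
    sum.\<close>
  have u_L2: "u \<in> L2_space \<mu>"
  proof -
    obtain n where "\<And>x. dist (S n x) (u x) < 1"
      using uniform_limitD[OF unif, of 1] by (auto simp: eventually_sequentially)
    then show ?thesis
      using near[of 1 n] L2_space_add[OF _ S[of n], of "\<lambda>x. u x - S n x"] by auto
  qed
  \<comment> \<open>Two errors of norm at most \<open>e\<close> enter through
    \<open>cmod_add_power2_le\<close>, each with factor 2; this gives the 4.\<close>
  have "(L2_norm \<mu> (\<lambda>x. u x - f x))\<^sup>2 \<le> 4 * e\<^sup>2" if e: "0 < e" for e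
  proof -
    have "\<forall>\<^sub>F n in sequentially. (\<forall>x\<in>UNIV. dist (S n x) (u x) < e) \<and>
        dist (L2_norm \<mu> (\<lambda>x. f x - S n x)) 0 < e"
      using uniform_limitD[OF unif e] tendstoD[OF lim e] by (rule eventually_conj)
    then obtain n where n: "\<And>x. dist (S n x) (u x) < e" "dist (L2_norm \<mu> (\<lambda>x. f x - S n x)) 0 < e"
      by (auto simp: eventually_sequentially)
    have "(L2_norm \<mu> (\<lambda>x. u x - f x))\<^sup>2
      \<le> (\<integral>x. 2 * (cmod (u x - S n x))\<^sup>2 + 2 * (cmod (f x - S n x))\<^sup>2 \<partial>\<mu>)"
      unfolding L2_norm_power2
    proof (rule integral_mono)
      show "integrable \<mu> (\<lambda>x. (cmod (u x - f x))\<^sup>2)"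
        by (intro L2_space_integrable L2_space_diff u_L2 f)
      show "integrable \<mu> (\<lambda>x. 2 * (cmod (u x - S n x))\<^sup>2 + 2 * (cmod (f x - S n x))\<^sup>2)"
        by (intro Bochner_Integration.integrable_add integrable_mult_right L2_space_integrable
            L2_space_diff u_L2 f S)
      show "(cmod (u x - f x))\<^sup>2 \<le> 2 * (cmod (u x - S n x))\<^sup>2 + 2 * (cmod (f x - S n x))\<^sup>2" for x
        using cmod_add_power2_le[of "u x - S n x" "S n x - f x"]
        by (simp add: norm_minus_commute)
    qed
    also have "\<dots> = 2 * (L2_norm \<mu> (\<lambda>x. u x - S n x))\<^sup>2 + 2 * (L2_norm \<mu> (\<lambda>x. f x - S n x))\<^sup>2"
      unfolding L2_norm_power2
      by (subst Bochner_Integration.integral_add)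
        (auto intro!: L2_space_integrable L2_space_diff u_L2 f S)
    also have "\<dots> \<le> 2 * e\<^sup>2 + 2 * e\<^sup>2"
    proof -
      have "(L2_norm \<mu> (\<lambda>x. f x - S n x))\<^sup>2 \<le> e\<^sup>2"
        using n(2) by (intro power_mono L2_norm_nonneg) simp
      then show ?thesis
        using near[OF e n(1)] by simp
    qed
    finally show ?thesis by simp
  qed
  \<comment> \<open>This choice of \<open>e\<close> turns \<open>4 * e\<^sup>2\<close> into
    \<open>d\<close>.\<close>
  from this[of "sqrt (d / 4)" for d] have "(L2_norm \<mu> (\<lambda>x. u x - f x))\<^sup>2 \<le> 0 + d" if "0 < d" for d
    using that by simp
  then have "(L2_norm \<mu> (\<lambda>x. u x - f x))\<^sup>2 \<le> 0"
    by (rule field_le_epsilon)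
  then show ?thesis
    using u_L2 f by (intro AE_eq_of_L2_norm_diff_eq_0) auto
qed

text \<open>The nodes may form a null set, so an identity almost everywhere gives no information
  there. The sum of the Fourier series is a continuous version whose distance to the projection is
  controlled at every single point.\<close>

lemma continuous_version_near_projection:
  fixes \<psi> :: "nat \<Rightarrow> 'a::topological_space \<Rightarrow> complex"
  assumes prob: "prob_space \<mu>" "sets borel \<subseteq> sets \<mu>" "space \<mu> = UNIV"
    and ON: "L2_orthonormal \<mu> UNIV \<psi>" and cont: "\<And>k. continuous_on UNIV (\<psi> k)"
    and g: "g \<in> L2_closure \<mu> (cfun_span (range \<psi>))"
    and low: "\<And>k. \<Lambda> k \<le> R \<longleftrightarrow> k \<le> D" and "0 \<le> R" "0 \<le> \<zeta>"
    and S: "sobolev_norm \<mu> \<psi> \<Lambda> \<sigma> g \<le> ennreal S" "0 \<le> S"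
    and H: "S = 0 \<or> tail_sup \<psi> \<Lambda> (\<sigma> - \<zeta>) R \<le> ennreal H" "0 \<le> H"
  obtains u where "continuous_version \<mu> g u"
    "\<And>x. cmod (u x - (\<Sum>k\<le>D. L2_inner \<mu> g (\<psi> k) * \<psi> k x)) \<le> S * H * (1 + R\<^sup>2) powr (- \<zeta> / 2)"
proof -
  interpret prob_space \<mu> by fact
  define c where "c k = L2_inner \<mu> g (\<psi> k)" for k
  define W where "W k = (1 + (\<Lambda> k)\<^sup>2)" for k
  have W: "0 < W k" for k
    unfolding W_def using zero_le_power2[of "\<Lambda> k"] by linarith
  have psi: "\<psi> k \<in> L2_space \<mu>" for k
    using ON by (simp add: L2_orthonormal_def)
  have g_L2: "g \<in> L2_space \<mu>"
    using g by (simp add: L2_closure_def)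
  \<comment> \<open>The sigma-algebra of \<open>\<mu>\<close> may be finer than the Borel one, so
    measurability is transferred along the inclusion.\<close>
  have continuous_measurable: "u \<in> borel_measurable \<mu>" if "continuous_on UNIV u" for u :: "'a \<Rightarrow> complex"
  proof -
    have "u \<in> borel_measurable borel"
      using that by (rule borel_measurable_continuous_onI)
    then show ?thesis
      using prob(2,3) by (auto simp: measurable_def)
  qed
  have lim: "(\<lambda>n. L2_norm \<mu> (\<lambda>x. g x - (\<Sum>k\<le>n. c k * \<psi> k x))) \<longlonglongrightarrow> 0"
    unfolding c_def by (rule L2_norm_orthonormal_series_tendsto[OF ON g])
  have AE: "AE x in \<mu>. u x = g x"
    if "uniform_limit UNIV (\<lambda>n x. \<Sum>k\<le>n. c k * \<psi> k x) u sequentially" "continuous_on UNIV u" for u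
    using prob(1) _ g_L2 continuous_measurable[OF that(2)] that(1) lim
    by (rule AE_eq_uniform_limit_L2_limit) (intro L2_space_sum L2_space_scale psi)
  have partial: "(\<Sum>k<n. (cmod (c k))\<^sup>2 * W k powr \<sigma>) \<le> S\<^sup>2" for n
    using S unfolding c_def W_def by (simp add: sobolev_norm_le_iff)
  show thesis
  proof (cases "S = 0")
    case True
    \<comment> \<open>All coefficients vanish, so the zero function is the required version without
      any use of a tail bound.\<close>
    have "c k = 0" for k
    proof -
      have "(cmod (c k))\<^sup>2 * W k powr \<sigma> \<le> (\<Sum>k<Suc k. (cmod (c k))\<^sup>2 * W k powr \<sigma>)"
        by (intro member_le_sum[of _ _ "\<lambda>k. (cmod (c k))\<^sup>2 * W k powr \<sigma>"]) auto
      with partial[of "Suc k"] have "(cmod (c k))\<^sup>2 * W k powr \<sigma> \<le> 0"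
        using True by simp
      moreover have "0 < W k powr \<sigma>"
        using W[of k] by simp
      ultimately show ?thesis
        by (simp add: mult_le_0_iff)
    qed
    then show thesis
      using that[of "\<lambda>_. 0"] AE[of "\<lambda>_. 0"] H(2) True
      by (auto simp: continuous_version_def c_def uniform_limit_const)
  next
    case False
    then have H1: "tail_sup \<psi> \<Lambda> (\<sigma> - \<zeta>) R \<le> ennreal H"
      using H by simp
    \<comment> \<open>The weight with exponent \<open>\<sigma>\<close> is split: the part with
      exponent \<open>\<sigma> - \<zeta>\<close> pairs with the tail supremum, while the rest
      produces the decay in \<open>R\<close>.\<close>
    define w where "w k = W k powr (\<sigma> - \<zeta>)" for k
    define v where "v k = W k powr (- (\<sigma> - \<zeta>))" for k
    have w_v: "w k * v k = 1" "0 \<le> w k" for k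
      using W[of k] by (simp_all add: w_def v_def flip: powr_add)
    have tail: "(\<Sum>k\<in>{D<..n}. (cmod (\<psi> k x))\<^sup>2 * v k) \<le> H\<^sup>2" for x n
    proof -
      have high: "R < \<Lambda> k \<longleftrightarrow> D < k" for k
        using low[of k] by (simp only: not_le[symmetric])
      have "{D<..n} = {k. k < Suc n \<and> \<Lambda> k > R}"
        \<comment> \<open>The truncation in \<open>tail_sup_le_iff\<close> is strict, so
          \<open>Suc n\<close> is what includes the index \<open>n\<close>.\<close>
        unfolding high by (simp only: set_eq_iff) (simp add: less_Suc_eq_le conj_commute)
      moreover have "(\<Sum>k | k < Suc n \<and> \<Lambda> k > R. (cmod (\<psi> k x))\<^sup>2 * v k) \<le> H\<^sup>2"
        unfolding v_def W_def using H1[unfolded tail_sup_le_iff[OF H(2)]] by blast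
      ultimately show ?thesis by simp
    qed
    have w_le: "w k \<le> W k powr \<sigma>" for k
      unfolding w_def using \<open>0 \<le> \<zeta>\<close> by (intro powr_mono) (auto simp: W_def)
    have summable: "summable (\<lambda>k. (cmod (c k))\<^sup>2 * w k)"
    proof (rule summableI_nonneg_bounded)
      show "(\<Sum>k<n. (cmod (c k))\<^sup>2 * w k) \<le> S\<^sup>2" for n
        using w_le by (intro order_trans[OF sum_mono partial[of n]] mult_left_mono) auto
    qed (use w_v in auto)
    obtain u where u: "uniform_limit UNIV (\<lambda>n x. \<Sum>k\<le>n. c k * \<psi> k x) u sequentially"
      using w_v(2,1) summable tail H(2) by (rule uniform_limit_weighted_series)
    have u_cont: "continuous_on UNIV u"
    proof (rule uniform_limit_theorem[OF _ u])
      show "\<forall>\<^sub>F n in sequentially. continuous_on UNIV (\<lambda>x. \<Sum>k\<le>n. c k * \<psi> k x)"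
        by (intro always_eventually allI continuous_intros cont)
    qed simp
    \<comment> \<open>On the tail \<open>W k\<close> is at least \<open>1 + R\<^sup>2\<close>, so
      lowering the exponent by \<open>\<zeta>\<close> gains
      \<open>(1 + R\<^sup>2) powr (- \<zeta>)\<close> in the square sum, and half that exponent
      after taking the root.\<close>
    let ?T = "S * (1 + R\<^sup>2) powr (- \<zeta> / 2)"
    have c_tail: "(\<Sum>k\<in>{D<..n}. (cmod (c k))\<^sup>2 * w k) \<le> ?T\<^sup>2" for n
    proof -
      have R: "0 < 1 + R\<^sup>2"
        using zero_le_power2[of R] by linarith
      have "(\<Sum>k\<in>{D<..n}. (cmod (c k))\<^sup>2 * w k)
        \<le> (\<Sum>k\<in>{D<..n}. (cmod (c k))\<^sup>2 * W k powr \<sigma> * (1 + R\<^sup>2) powr (- \<zeta>))"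
      proof (rule sum_mono)
        fix k assume "k \<in> {D<..n}"
        then have "R < \<Lambda> k"
          using low[of k] by auto
        then have "1 + R\<^sup>2 \<le> W k"
          using \<open>0 \<le> R\<close> by (auto simp: W_def intro: power_mono)
        then have "W k powr (- \<zeta>) \<le> (1 + R\<^sup>2) powr (- \<zeta>)"
          using R \<open>0 \<le> \<zeta>\<close> by (intro powr_mono2') auto
        moreover have "w k = W k powr \<sigma> * W k powr (- \<zeta>)"
          using powr_add[of "W k" \<sigma> "- \<zeta>"] by (simp add: w_def)
        ultimately show "(cmod (c k))\<^sup>2 * w k \<le> (cmod (c k))\<^sup>2 * W k powr \<sigma> * (1 + R\<^sup>2) powr (- \<zeta>)"
          by (simp add: mult_left_mono mult.assoc)
      qed
      also have "\<dots> \<le> S\<^sup>2 * (1 + R\<^sup>2) powr (- \<zeta>)"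
        unfolding sum_distrib_right[symmetric]
      proof (rule mult_right_mono)
        have "(\<Sum>k\<in>{D<..n}. (cmod (c k))\<^sup>2 * W k powr \<sigma>) \<le> (\<Sum>k<Suc n. (cmod (c k))\<^sup>2 * W k powr \<sigma>)"
          by (intro sum_mono2) auto
        also have "\<dots> \<le> S\<^sup>2"
          by (rule partial)
        finally show "(\<Sum>k\<in>{D<..n}. (cmod (c k))\<^sup>2 * W k powr \<sigma>) \<le> S\<^sup>2" .
      qed simp
      also have "\<dots> = ?T\<^sup>2"
        using R by (simp add: power_mult_distrib powr_power)
      finally show ?thesis .
    qed
    \<comment> \<open>The weighted Cauchy-Schwarz bound holds for every partial sum beyond
      \<open>D\<close> and passes to the pointwise limit.\<close>
    have near: "cmod (u x - (\<Sum>k\<le>D. c k * \<psi> k x)) \<le> ?T * H" for x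
    proof (rule tendsto_upperbound)
      show "(\<lambda>n. cmod ((\<Sum>k\<le>n. c k * \<psi> k x) - (\<Sum>k\<le>D. c k * \<psi> k x)))
          \<longlonglongrightarrow> cmod (u x - (\<Sum>k\<le>D. c k * \<psi> k x))"
        by (intro tendsto_intros tendsto_uniform_limitI[OF u]) auto
      have "cmod ((\<Sum>k\<le>n. c k * \<psi> k x) - (\<Sum>k\<le>D. c k * \<psi> k x)) \<le> ?T * H" if "D \<le> n" for n
      proof -
        have "(\<Sum>k\<le>n. c k * \<psi> k x) - (\<Sum>k\<le>D. c k * \<psi> k x) = (\<Sum>k\<in>{..n} - {..D}. c k * \<psi> k x)"
          using that by (intro sum_diff[symmetric]) auto
        also have "{..n} - {..D} = {D<..n}"
          by auto
        finally show ?thesis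
          using cmod_sum_mult_le_weighted[of "{D<..n}" w v c ?T "\<lambda>k. \<psi> k x" H] w_v c_tail tail S(2) H(2)
          by simp
      qed
      then show "\<forall>\<^sub>F n in sequentially. cmod ((\<Sum>k\<le>n. c k * \<psi> k x) - (\<Sum>k\<le>D. c k * \<psi> k x)) \<le> ?T * H"
        by (auto simp: eventually_sequentially)
    qed simp
    have "continuous_version \<mu> g u"
      using u_cont AE[OF u u_cont] by (simp add: continuous_version_def)
    then show thesis
      using that[of u] near by (simp add: c_def mult_ac)
  qed
qed

section \<open>Least squares\<close>

text \<open>Optimality along the real line through the minimiser already gives
  \<open>\<parallel>y - (p + v)\<parallel>\<^sup>2 = \<parallel>y - p\<parallel>\<^sup>2 + \<parallel>v\<parallel>\<^sup>2\<close>.\<close>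

lemma least_squares_deviation_le:
  fixes y p v :: "'i \<Rightarrow> complex" and w :: "'i \<Rightarrow> real"
  assumes w: "\<And>j. j \<in> J \<Longrightarrow> 0 \<le> w j"
    and min: "\<And>t :: real. (\<Sum>j\<in>J. (cmod (y j - p j))\<^sup>2 * w j)
               \<le> (\<Sum>j\<in>J. (cmod (y j - (p j + of_real t * v j)))\<^sup>2 * w j)"
  shows "(\<Sum>j\<in>J. (cmod (v j))\<^sup>2 * w j) \<le> (\<Sum>j\<in>J. (cmod (y j - (p j + v j)))\<^sup>2 * w j)"
proof -
  define a where "a = (\<Sum>j\<in>J. (cmod (y j - p j))\<^sup>2 * w j)"
  define b where "b = (\<Sum>j\<in>J. Re ((y j - p j) * cnj (v j)) * w j)"
  define c where "c = (\<Sum>j\<in>J. (cmod (v j))\<^sup>2 * w j)"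
  have expand: "(\<Sum>j\<in>J. (cmod (y j - (p j + of_real t * v j)))\<^sup>2 * w j) = a - 2 * t * b + t\<^sup>2 * c"
    for t :: real
  proof -
    have "(cmod (y j - (p j + of_real t * v j)))\<^sup>2 * w j
      = (cmod (y j - p j))\<^sup>2 * w j - 2 * t * (Re ((y j - p j) * cnj (v j)) * w j)
        + t\<^sup>2 * ((cmod (v j))\<^sup>2 * w j)" for j
      by (simp add: cmod_power2) (simp add: power2_eq_square algebra_simps)
    then show ?thesis
      by (simp add: a_def b_def c_def sum.distrib sum_subtractf sum_distrib_left)
  qed
  have "0 \<le> a" "0 \<le> c"
    using w by (auto simp: a_def c_def intro!: sum_nonneg)
  have le: "2 * t * b \<le> t\<^sup>2 * c" for t
    using min[of t] unfolding expand a_def[symmetric] by simp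
  \<comment> \<open>Only this sign is used below: the residual at \<open>t = 1\<close> is
    \<open>a - 2 * b + c\<close>, hence at least \<open>c\<close>. If \<open>b\<close> were
    positive, the step \<open>b / c\<close>, which minimises the quadratic, would lower the
    residual.\<close>
  have "b \<le> 0"
  proof (rule ccontr)
    assume "\<not> b \<le> 0"
    then have b: "0 < b" by simp
    have "0 < c"
      using le[of 1] b by simp
    have "2 * (b / c) * b \<le> (b / c)\<^sup>2 * c"
      by (rule le)
    then have "b * b \<le> 0"
      using \<open>0 < c\<close> by (simp add: power2_eq_square field_simps)
    with b show False
      by (simp add: mult_le_0_iff)
  qed
  then show ?thesis
    using expand[of 1] \<open>0 \<le> a\<close> by (simp add: c_def)
qed

text \<open>Both sides agree in their pure squares. In the mixed term \<open>\<kappa>\<close> is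
  replaced by the larger \<open>sqrt (1 + \<kappa>) * sqrt \<kappa>\<close>.\<close>

lemma sqrt_weighted_sum_le:
  fixes \<kappa> E b :: real
  assumes "0 \<le> \<kappa>" "0 \<le> E" "0 \<le> b"
  shows "\<kappa> * (E + b)\<^sup>2 + E\<^sup>2 \<le> (sqrt (1 + \<kappa>) * E + sqrt \<kappa> * b)\<^sup>2"
proof -
  have "\<kappa> = sqrt \<kappa> * sqrt \<kappa>"
    using assms by simp
  also have "\<dots> \<le> sqrt (1 + \<kappa>) * sqrt \<kappa>"
    using assms by (intro mult_right_mono) auto
  finally have "\<kappa> * (E * b) \<le> (sqrt (1 + \<kappa>) * sqrt \<kappa>) * (E * b)"
    using assms by (intro mult_right_mono) auto
  moreover have "(sqrt (1 + \<kappa>) * E + sqrt \<kappa> * b)\<^sup>2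
     = (1 + \<kappa>) * E\<^sup>2 + 2 * ((sqrt (1 + \<kappa>) * sqrt \<kappa>) * (E * b)) + \<kappa> * b\<^sup>2"
    using assms by (simp add: power2_sum power_mult_distrib algebra_simps)
  ultimately show ?thesis
    by (simp add: power2_sum algebra_simps)
qed

text \<open>Coefficients of the error up to \<open>D\<close> are those of \<open>P - p\<close>,
  later ones those of \<open>g\<close> alone. On the low part the Sobolev weight costs at most
  \<open>(1 + R\<^sup>2) powr \<zeta>\<close>, which cancels the decay of \<open>E\<close> in
  \<open>near\<close> and remains only with \<open>\<beta>\<close>.\<close>

lemma sobolev_norm_least_squares_le:
  fixes \<psi> :: "nat \<Rightarrow> 'a \<Rightarrow> complex"
  defines "V \<equiv> \<lambda>D. cfun_span (\<psi> ` {..D})"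
  assumes ON: "L2_orthonormal \<mu> UNIV \<psi>" and g: "g \<in> L2_space \<mu>"
    and A: "0 < A" and B: "0 < B" and w: "\<And>j. j \<in> J \<Longrightarrow> 0 \<le> w j" "sum w J \<le> B"
    and stable: "\<And>q. q \<in> V D \<Longrightarrow> A * (L2_norm \<mu> q)\<^sup>2 \<le> (\<Sum>j\<in>J. (cmod (q (t j)))\<^sup>2 * w j)"
    and p: "p \<in> V D"
    and min: "\<And>q. q \<in> V D \<Longrightarrow>
      (\<Sum>j\<in>J. (cmod (y j - p (t j)))\<^sup>2 * w j) \<le> (\<Sum>j\<in>J. (cmod (y j - q (t j)))\<^sup>2 * w j)"
    and low: "\<And>k. k \<le> D \<Longrightarrow> 0 \<le> \<Lambda> k \<and> \<Lambda> k \<le> R"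
    and near: "\<And>j. j \<in> J \<Longrightarrow> cmod (y j - (\<Sum>k\<le>D. L2_inner \<mu> g (\<psi> k) * \<psi> k (t j)))
      \<le> \<beta> + E * (1 + R\<^sup>2) powr (- \<zeta> / 2)"
    and tail: "\<And>n. (\<Sum>k\<in>{D<..n}. (cmod (L2_inner \<mu> g (\<psi> k)))\<^sup>2 * (1 + (\<Lambda> k)\<^sup>2) powr \<zeta>) \<le> E\<^sup>2"
    and pos: "0 \<le> \<zeta>" "0 \<le> E" "0 \<le> \<beta>"
  shows "sobolev_norm \<mu> \<psi> \<Lambda> \<zeta> (\<lambda>x. g x - p x)
    \<le> ennreal (sqrt (1 + B / A) * E + sqrt (B / A) * \<beta> * (1 + R\<^sup>2) powr (\<zeta> / 2))"
proof -
  define c where "c k = L2_inner \<mu> g (\<psi> k)" for k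
  define b where "b = (1 + R\<^sup>2) powr (\<zeta> / 2)"
  define P where "P = (\<lambda>x. \<Sum>k\<le>D. c k * \<psi> k x)"
  define X where "X = (\<Sum>k\<le>D. (cmod (L2_inner \<mu> (\<lambda>x. g x - p x) (\<psi> k)))\<^sup>2)"
  have ON': "L2_orthonormal \<mu> {..D} \<psi>"
    using L2_orthonormal_subset[OF ON] by simp
  have psi: "\<psi> k \<in> L2_space \<mu>" for k
    using ON by (simp add: L2_orthonormal_def)
  have b: "0 < b" "b\<^sup>2 = (1 + R\<^sup>2) powr \<zeta>" "(1 + R\<^sup>2) powr (- \<zeta> / 2) = 1 / b"
  proof -
    have "0 < 1 + R\<^sup>2"
      using zero_le_power2[of R] by linarith
    then show "0 < b" "b\<^sup>2 = (1 + R\<^sup>2) powr \<zeta>" "(1 + R\<^sup>2) powr (- \<zeta> / 2) = 1 / b"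
      by (simp_all add: b_def powr_power powr_minus_divide)
  qed
  obtain a where a: "p = (\<lambda>x. \<Sum>k\<le>D. a k * \<psi> k x)"
    using p by (auto simp: V_def cfun_span_finite_image)
  have p_L2: "p \<in> L2_space \<mu>"
    unfolding a by (intro L2_space_sum L2_space_scale psi)
  have inner: "L2_inner \<mu> (\<lambda>x. g x - p x) (\<psi> k) = c k - (if k \<le> D then a k else 0)" for k
  proof -
    have "L2_inner \<mu> p (\<psi> k) = (\<Sum>i\<le>D. a i * (if i = k then 1 else 0))"
      unfolding a using ON by (subst L2_inner_sum_left) (simp_all add: psi L2_orthonormal_def)
    then show ?thesis
      by (simp add: L2_inner_diff_left g p_L2 psi c_def if_distrib[of "\<lambda>z. _ * z"] cong: if_cong)
  qed
  have diff: "(\<lambda>x. P x - p x) = (\<lambda>x. \<Sum>k\<le>D. (c k - a k) * \<psi> k x)"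
    by (simp add: P_def a left_diff_distrib sum_subtractf)
  then have X: "X = (L2_norm \<mu> (\<lambda>x. P x - p x))\<^sup>2"
    by (simp add: X_def inner L2_norm_orthonormal_sum[OF _ ON'])
  have P_V: "P \<in> V D" and diff_V: "(\<lambda>x. P x - p x) \<in> V D"
    unfolding diff unfolding P_def V_def by (auto simp: cfun_span_finite_image)
  \<comment> \<open>The direction of variation is \<open>P - p\<close>: a full step leads from
    \<open>p\<close> to \<open>P\<close>, so the right-hand side is the residual of
    \<open>P\<close>, which \<open>near\<close> controls.\<close>
  have "(\<Sum>j\<in>J. (cmod (P (t j) - p (t j)))\<^sup>2 * w j)
      \<le> (\<Sum>j\<in>J. (cmod (y j - (p (t j) + (P (t j) - p (t j)))))\<^sup>2 * w j)"
  proof (rule least_squares_deviation_le)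
    fix s :: real
    have "(\<lambda>x. p x + of_real s * (P x - p x)) \<in> V D"
      using cfun.span_add[OF p[unfolded V_def] cfun.span_scale[OF diff_V[unfolded V_def], of "of_real s"]]
      by (simp add: V_def plus_fun_def)
    from min[OF this] show "(\<Sum>j\<in>J. (cmod (y j - p (t j)))\<^sup>2 * w j)
      \<le> (\<Sum>j\<in>J. (cmod (y j - (p (t j) + of_real s * (P (t j) - p (t j)))))\<^sup>2 * w j)" .
  qed (rule w)
  also have "\<dots> \<le> (\<Sum>j\<in>J. (\<beta> + E / b)\<^sup>2 * w j)"
    using near[unfolded b(3)] w(1)
    by (intro sum_mono mult_right_mono power_mono) (auto simp: P_def c_def)
  also have "\<dots> \<le> (\<beta> + E / b)\<^sup>2 * B"
    unfolding sum_distrib_left[symmetric] by (intro mult_left_mono w) simp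
  finally have "A * X \<le> (\<beta> + E / b)\<^sup>2 * B"
    using stable[OF diff_V] by (simp add: X)
  then have "X \<le> B / A * (\<beta> + E / b)\<^sup>2"
    using A by (simp add: field_simps)
  \<comment> \<open>Multiplying by \<open>b\<^sup>2\<close> moves the factor from \<open>E\<close>
    to \<open>\<beta>\<close>, as \<open>(\<beta> + E / b) * b = E + \<beta> * b\<close>.\<close>
  then have "X * b\<^sup>2 \<le> (B / A * (\<beta> + E / b)\<^sup>2) * b\<^sup>2"
    by (intro mult_right_mono) auto
  also have "\<dots> = B / A * (E + \<beta> * b)\<^sup>2"
    using b(1) by (simp add: power_mult_distrib[symmetric] distrib_right mult.assoc add.commute)
  finally have X_le: "X * b\<^sup>2 \<le> B / A * (E + \<beta> * b)\<^sup>2" .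

  let ?s = "\<lambda>k. (cmod (L2_inner \<mu> (\<lambda>x. g x - p x) (\<psi> k)))\<^sup>2 * (1 + (\<Lambda> k)\<^sup>2) powr \<zeta>"
  have "(\<Sum>k<n. ?s k) \<le> (sqrt (1 + B / A) * E + sqrt (B / A) * \<beta> * b)\<^sup>2" for n
  proof -
    \<comment> \<open>The enlarged index set also covers the case that \<open>n\<close> does not
      exceed \<open>D\<close>; the extra terms are nonnegative.\<close>
    have "(\<Sum>k<n. ?s k) \<le> (\<Sum>k\<in>{..D} \<union> {D<..n}. ?s k)"
      by (rule sum_mono2) auto
    also have "\<dots> = (\<Sum>k\<le>D. ?s k) + (\<Sum>k\<in>{D<..n}. ?s k)"
      by (rule sum.union_disjoint) auto
    also have "(\<Sum>k\<le>D. ?s k) \<le> X * b\<^sup>2"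
      unfolding X_def sum_distrib_right b(2) using low pos(1)
      by (intro sum_mono mult_left_mono powr_mono2) (auto intro: power_mono)
    also have "(\<Sum>k\<in>{D<..n}. ?s k) \<le> E\<^sup>2"
      using tail[of n] by (simp add: inner c_def)
    also have "X * b\<^sup>2 + E\<^sup>2 \<le> B / A * (E + \<beta> * b)\<^sup>2 + E\<^sup>2"
      using X_le by simp
    also have "\<dots> \<le> (sqrt (1 + B / A) * E + sqrt (B / A) * (\<beta> * b))\<^sup>2"
      using A B pos b(1) by (intro sqrt_weighted_sum_le) auto
    finally show ?thesis
      by (simp add: mult.assoc)
  qed
  then show ?thesis
    using A B pos unfolding b_def by (subst sobolev_norm_le_iff) auto
qed

section \<open>The adapted system\<close>

lemma admissible_operator_L2_lipschitz:
  assumes basis: "spectral_basis \<mu> \<phi> lam" and "0 \<le> \<sigma>"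
    and adm: "admissible_operator \<mu> \<phi> lam r \<sigma> smul G F"
  obtains C where "0 < C" "\<And>f g. L2_norm \<mu> (\<lambda>x. F f x - F g x) \<le> C * norm (f - g)"
proof -
  obtain C where C: "\<And>f. sobolev_norm \<mu> \<phi> lam \<sigma> (F f) \<le> ennreal (C * norm f)"
    using adm by (auto simp: admissible_operator_def)
  \<comment> \<open>The constant of boundedness need not be positive; a positive one allows division
    by it in the density argument.\<close>
  define C' where "C' = max C 1"
  have F: "F f \<in> L2_closure \<mu> (cfun_span (range \<phi>))" for f
    using adm by (auto simp: admissible_operator_def sobolev_space_def)
  then have meas: "F f \<in> borel_measurable \<mu>" for f
    by (auto simp: L2_closure_def L2_space_def)
  have "L2_norm \<mu> (\<lambda>x. F f x - F g x) \<le> C' * norm (f - g)" for f g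
  proof -
    \<comment> \<open>\<open>F\<close> is additive only almost everywhere, and additivity speaks of
      sums; so \<open>f\<close> is written as \<open>(f - g) + g\<close>.\<close>
    have "AE x in \<mu>. F ((f - g) + g) x = F (f - g) x + F g x"
      using adm unfolding admissible_operator_def by blast
    then have "L2_norm \<mu> (\<lambda>x. F f x - F g x) = L2_norm \<mu> (F (f - g))"
      by (intro L2_norm_cong_AE) (auto intro: borel_measurable_diff meas)
    also have "\<dots> \<le> C' * norm (f - g)"
    proof (rule L2_norm_le_sobolev_norm[OF _ F \<open>0 \<le> \<sigma>\<close>])
      show "L2_orthonormal \<mu> UNIV \<phi>"
        using basis by (simp add: spectral_basis_def)
      have "ennreal (C * norm (f - g)) \<le> ennreal (C' * norm (f - g))"
        by (intro ennreal_leI mult_right_mono) (auto simp: C'_def)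
      with C show "sobolev_norm \<mu> \<phi> lam \<sigma> (F (f - g)) \<le> ennreal (C' * norm (f - g))"
        using order_trans by blast
    qed (auto simp: C'_def)
    finally show ?thesis .
  qed
  then show thesis
    using that[of C'] by (auto simp: C'_def)
qed

text \<open>Lipschitz continuity into the square-integrable functions carries the density of the
  union of the \<open>G m\<close> over to the images.\<close>

lemma admissible_operator_dense_image:
  assumes basis: "spectral_basis \<mu> \<phi> lam" and "0 \<le> \<sigma>"
    and G: "approximating_subspaces smul G"
    and adm: "admissible_operator \<mu> \<phi> lam r \<sigma> smul G F"
  shows "F f \<in> L2_closure \<mu> (\<Union>m. F ` G m)"
proof -
  obtain C where C: "0 < C" "\<And>f g. L2_norm \<mu> (\<lambda>x. F f x - F g x) \<le> C * norm (f - g)"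
    using admissible_operator_L2_lipschitz[OF basis \<open>0 \<le> \<sigma>\<close> adm] by blast
  have "\<exists>v\<in>\<Union>m. F ` G m. L2_norm \<mu> (\<lambda>x. F f x - v x) < e" if "0 < e" for e
  proof -
    have "f \<in> closure (\<Union>m. G m)"
      using G by (simp add: approximating_subspaces_def)
    then obtain q where q: "q \<in> (\<Union>m. G m)" "dist q f < e / C"
      using C(1) \<open>0 < e\<close> unfolding closure_approachable by (metis divide_pos_pos)
    have "L2_norm \<mu> (\<lambda>x. F f x - F q x) \<le> C * norm (f - q)"
      by (rule C)
    also have "\<dots> < e"
      using q(2) C(1) by (simp add: dist_norm norm_minus_commute pos_less_divide_eq mult.commute)
    finally show ?thesis
      using q(1) by blast
  qed
  then show ?thesis
    using adm by (auto simp: admissible_operator_def sobolev_space_def L2_closure_def)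
qed

text \<open>If \<open>d\<close> were bounded, the subspaces \<open>F ` G m\<close> would be eventually constant, and their
  common value, being closed in \<open>L\<^sup>2\<close>, would be the whole range of \<open>F\<close>.\<close>

lemma adapted_system_unbounded:
  assumes basis: "spectral_basis \<mu> \<phi> lam" and "0 \<le> \<sigma>"
    and G: "approximating_subspaces smul G"
    and adm: "admissible_operator \<mu> \<phi> lam r \<sigma> smul G F"
    and sys: "adapted_system \<mu> r G F d \<psi> \<Lambda>"
  shows "\<exists>m. n < d m"
proof (rule ccontr)
  assume "\<not> (\<exists>m. n < d m)"
  then have "finite (range d)"
    by (intro finite_subset[of "range d" "{..n}"]) (auto simp: not_less)
  then have "Max (range d) \<in> range d"
    by (intro Max_in) auto
  then obtain M where M: "\<And>m. d m \<le> d M"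
    using \<open>finite (range d)\<close> by (metis Max_ge imageE rangeI)
  have ON: "L2_orthonormal \<mu> {..d M} \<psi>" and span: "\<And>m. cfun_span (\<psi> ` {..d m}) = F ` G m"
    using sys by (auto simp: adapted_system_def)
  let ?T = "\<psi> ` {..d M}"
  have "?T \<subseteq> range F"
    using cfun.span_superset[of ?T] span[of M] by auto
  moreover have "\<exists>g\<in>cfun_span ?T. AE x in \<mu>. h x = g x" if "h \<in> range F" for h
  proof -
    have h: "h \<in> L2_closure \<mu> (\<Union>m. F ` G m)"
      using admissible_operator_dense_image[OF assms(1-4)] that by auto
    then have h_L2: "h \<in> L2_space \<mu>"
      by (simp add: L2_closure_def)
    \<comment> \<open>The projection is at least as close to \<open>h\<close> as any approximant
      from the images, all of which lie in the span of \<open>?T\<close>; hence its distance to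
      \<open>h\<close> is zero.\<close>
    define g where "g = (\<lambda>x. \<Sum>k\<le>d M. L2_inner \<mu> h (\<psi> k) * \<psi> k x)"
    have g: "g \<in> cfun_span ?T"
      by (auto simp: g_def cfun_span_finite_image)
    have "L2_norm \<mu> (\<lambda>x. h x - g x) \<le> 0 + e" if "0 < e" for e
    proof -
      have "\<exists>v\<in>\<Union>m. F ` G m. L2_norm \<mu> (\<lambda>x. h x - v x) < e"
        using h \<open>0 < e\<close> unfolding L2_closure_def by blast
      then obtain m v where v: "v \<in> F ` G m" "L2_norm \<mu> (\<lambda>x. h x - v x) < e"
        by blast
      have "v \<in> cfun_span ?T"
        by (rule subsetD[OF cfun.span_mono[OF image_mono] v(1)[folded span]]) (use M in simp)
      then have "L2_norm \<mu> (\<lambda>x. h x - g x) \<le> L2_norm \<mu> (\<lambda>x. h x - v x)"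
        unfolding g_def by (intro L2_norm_projection_le ON h_L2) auto
      with v(2) show ?thesis by simp
    qed
    then have "L2_norm \<mu> (\<lambda>x. h x - g x) \<le> 0"
      by (rule field_le_epsilon)
    then have "L2_norm \<mu> (\<lambda>x. h x - g x) = 0"
      using L2_norm_nonneg order_antisym by blast
    moreover have "g \<in> L2_space \<mu>"
      using cfun_span_subset_L2_space[OF ON] g by blast
    ultimately show ?thesis
      using g h_L2 by (intro bexI[of _ g] AE_eq_of_L2_norm_diff_eq_0) auto
  qed
  ultimately have "\<not> L2_infinite_dim \<mu> (range F)"
    unfolding L2_infinite_dim_def by blast
  then show False
    using adm by (simp add: admissible_operator_def)
qed

text \<open>Since \<open>d\<close> is unbounded, every index lies in some block, and
  \<open>\<Lambda>\<close> is constant on blocks. In terms of indices this identifies the space of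
  degree \<open>r m\<close> for the adapted system with the image of \<open>G m\<close>.\<close>

lemma adapted_system_low_iff:
  assumes sys: "adapted_system \<mu> r G F d \<psi> \<Lambda>" and unbounded: "\<And>n. \<exists>m. n < d m"
    and r: "strict_mono r"
  shows "\<Lambda> k \<le> r m \<longleftrightarrow> k \<le> d m"
proof -
  have d: "mono d" and low: "\<And>k. k \<le> d 0 \<Longrightarrow> \<Lambda> k = r 0"
    and step: "\<And>m k. k \<in> {d m + 1..d (Suc m)} \<Longrightarrow> \<Lambda> k = r (Suc m)"
    using sys by (auto simp: adapted_system_def)
  \<comment> \<open>The least such \<open>i\<close> names the block that introduced
    \<open>\<psi> k\<close> and passes over steps at which nothing was added.\<close>
  define i where "i = (LEAST i. k \<le> d i)"
  have ex: "\<exists>i. k \<le> d i"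
    using unbounded[of k] less_imp_le by blast
  have i: "k \<le> d i"
    unfolding i_def using ex by (rule LeastI_ex)
  have less: "d j < k" if "j < i" for j
    using that not_less_Least[of j "\<lambda>i. k \<le> d i"] by (auto simp: i_def)
  have "\<Lambda> k = r i"
  proof (cases i)
    case 0
    then show ?thesis
      using i low by simp
  next
    case (Suc j)
    then show ?thesis
      using i less[of j] step[of k j] by simp
  qed
  moreover have "k \<le> d m \<longleftrightarrow> i \<le> m"
    using i less[of m] monoD[OF d, of i m] by (metis not_less order_trans)
  ultimately show ?thesis
    using r by (simp add: strict_mono_less_eq)
qed

text \<open>Orthonormality concerns two indices at a time, and any two lie below a common
  \<open>d m\<close>.\<close>

lemma adapted_system_orthonormal:
  assumes "adapted_system \<mu> r G F d \<psi> \<Lambda>" and unbounded: "\<And>n. \<exists>m. n < d m"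
  shows "L2_orthonormal \<mu> UNIV \<psi>"
proof -
  have "\<exists>m. i \<le> d m \<and> j \<le> d m" for i j
    using unbounded[of "max i j"] by (metis less_imp_le max.bounded_iff)
  moreover have "\<And>m. L2_orthonormal \<mu> {..d m} \<psi>"
    using assms(1) by (simp add: adapted_system_def)
  ultimately show ?thesis
    unfolding L2_orthonormal_def by (metis UNIV_I atMost_iff)
qed

section \<open>The error estimate\<close>

lemma continuous_on_diffusion_poly:
  assumes "spectral_basis \<mu> \<phi> lam" "q \<in> diffusion_poly \<phi> lam r"
  shows "continuous_on UNIV q"
proof -
  obtain J a where "q = (\<lambda>x. \<Sum>k\<in>J. a k * \<phi> k x)"
    using assms(2) unfolding diffusion_poly_def by (rule cfun_span_image_obtain)
  then show ?thesis
    using assms(1) by (auto simp: spectral_basis_def intro!: continuous_intros)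
qed

theorem corollary17:
  fixes \<mu> :: "'a::topological_space measure"
    and \<phi> :: "nat \<Rightarrow> 'a \<Rightarrow> complex" and lam :: "nat \<Rightarrow> real"
    and L :: "nat \<Rightarrow> nat" and node :: "nat \<Rightarrow> nat \<Rightarrow> 'a" and \<tau> :: "nat \<Rightarrow> nat \<Rightarrow> real"
    and r :: "nat \<Rightarrow> real" and A B \<sigma> \<zeta> \<beta> :: real
    and smul :: "complex \<Rightarrow> 'x::banach \<Rightarrow> 'x" and G :: "nat \<Rightarrow> 'x set"
    and F :: "'x \<Rightarrow> 'a \<Rightarrow> complex"
    and d :: "nat \<Rightarrow> nat" and \<psi> :: "nat \<Rightarrow> 'a \<Rightarrow> complex" and \<Lambda> :: "nat \<Rightarrow> real"
    and f p :: 'x and m :: nat and y :: "nat \<Rightarrow> complex"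
  assumes "prob_space \<mu>" and "space \<mu> = UNIV" and "sets borel \<subseteq> sets \<mu>"
    and "spectral_basis \<mu> \<phi> lam"
    and "marcinkiewicz_zygmund \<mu> \<phi> lam L node \<tau> r A B"
    and "complex_scaling smul"
    and "approximating_subspaces smul G"
    and "admissible_operator \<mu> \<phi> lam r \<sigma> smul G F"
    and "adapted_system \<mu> r G F d \<psi> \<Lambda>"
    and "0 \<le> \<zeta>" and "\<zeta> \<le> \<sigma>" and "0 \<le> \<beta>"
    and "\<exists>u. continuous_version \<mu> (F f) u"
    and "\<And>u j. continuous_version \<mu> (F f) u \<Longrightarrow> j \<in> {1..L m} \<Longrightarrow>
           cmod (y j - u (node m j)) \<le> \<beta>"
    and "is_arg_min (\<lambda>q. \<Sum>j=1..L m. (cmod (y j - F q (node m j)))\<^sup>2 * \<tau> m j) (\<lambda>q. q \<in> G m) p"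
  shows "sobolev_norm \<mu> \<psi> \<Lambda> \<zeta> (\<lambda>t. F f t - F p t)
       \<le> ennreal (sqrt (1 + B / A)) * sobolev_norm \<mu> \<psi> \<Lambda> \<sigma> (F f) * tail_sup \<psi> \<Lambda> (\<sigma> - \<zeta>) (r m)
         + ennreal (sqrt (B / A) * \<beta> * (1 + (r m)\<^sup>2) powr (\<zeta> / 2))"
proof -
  interpret prob_space \<mu> by fact
  note basis = \<open>spectral_basis \<mu> \<phi> lam\<close> and sys = \<open>adapted_system \<mu> r G F d \<psi> \<Lambda>\<close>
    and adm = \<open>admissible_operator \<mu> \<phi> lam r \<sigma> smul G F\<close>
  have "0 \<le> \<sigma>"
    using assms(10,11) by linarith
  have unbounded: "\<exists>m. n < d m" for n
    using adapted_system_unbounded[OF basis \<open>0 \<le> \<sigma>\<close> assms(7) adm sys] .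
  have ON: "L2_orthonormal \<mu> UNIV \<psi>"
    using adapted_system_orthonormal[OF sys unbounded] .
  have r: "strict_mono r" "0 \<le> r m" and A: "0 < A" and B: "0 < B"
    and \<tau>: "\<And>j. j \<in> {1..L m} \<Longrightarrow> 0 < \<tau> m j"
    and MZ: "\<And>q. q \<in> diffusion_poly \<phi> lam (r m) \<Longrightarrow>
        A * (L2_norm \<mu> q)\<^sup>2 \<le> (\<Sum>j=1..L m. (cmod (q (node m j)))\<^sup>2 * \<tau> m j) \<and>
        (\<Sum>j=1..L m. (cmod (q (node m j)))\<^sup>2 * \<tau> m j) \<le> B * (L2_norm \<mu> q)\<^sup>2"
    using assms(5) by (auto simp: marcinkiewicz_zygmund_def)
  have low: "\<Lambda> k \<le> r i \<longleftrightarrow> k \<le> d i" for k i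
    using adapted_system_low_iff[OF sys unbounded r(1)] .
  have span: "cfun_span (\<psi> ` {..d i}) = F ` G i" for i
    using sys by (simp add: adapted_system_def)
  have poly: "F ` G i \<subseteq> diffusion_poly \<phi> lam (r i)" for i
    using adm by (simp add: admissible_operator_def)
  have "continuous_on UNIV (\<psi> k)" for k
  proof -
    obtain i where "k \<le> d i"
      using unbounded[of k] less_imp_le by blast
    then have "\<psi> k \<in> F ` G i"
      unfolding span[symmetric] by (intro cfun.span_base) auto
    then show ?thesis
      using poly continuous_on_diffusion_poly[OF basis] by blast
  qed
  note cont = this
  have dense: "F f \<in> L2_closure \<mu> (cfun_span (range \<psi>))"
  proof -
    have "(\<Union>i. F ` G i) \<subseteq> cfun_span (range \<psi>)"
      unfolding span[symmetric] by (intro UN_least cfun.span_mono) auto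
    then show ?thesis
      using admissible_operator_dense_image[OF basis \<open>0 \<le> \<sigma>\<close> assms(7) adm, of f]
      unfolding L2_closure_def by blast
  qed
  \<comment> \<open>A negative value would lie below \<open>r 0\<close> and so place
    \<open>k\<close> in the first block, where \<open>\<Lambda>\<close> equals the nonnegative
    \<open>r 0\<close>.\<close>
  have low_nonneg: "0 \<le> \<Lambda> k" if "k \<le> d m" for k
  proof (rule ccontr)
    assume neg: "\<not> 0 \<le> \<Lambda> k"
    have "0 \<le> r 0"
      using assms(5) by (simp add: marcinkiewicz_zygmund_def)
    with neg have "k \<le> d 0"
      using low[of k 0] by simp
    then show False
      using sys neg \<open>0 \<le> r 0\<close> by (simp add: adapted_system_def)
  qed
  have one: "(\<lambda>_. 1) \<in> diffusion_poly \<phi> lam (r m)"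
  proof -
    have "\<psi> 0 \<in> F ` G m"
      unfolding span[symmetric] by (intro cfun.span_base) simp
    moreover have "\<psi> 0 = (\<lambda>_. 1)"
      using sys by (simp add: adapted_system_def)
    ultimately show ?thesis
      using poly[of m] by auto
  qed
  \<comment> \<open>The upper Marcinkiewicz-Zygmund bound for the constant 1, whose norm is
    1.\<close>
  have weights: "sum (\<tau> m) {1..L m} \<le> B"
    using MZ[OF one] by (simp add: L2_norm_def prob_space)
  have p: "p \<in> G m" and min: "\<And>q. q \<in> G m \<Longrightarrow>
      (\<Sum>j=1..L m. (cmod (y j - F p (node m j)))\<^sup>2 * \<tau> m j)
        \<le> (\<Sum>j=1..L m. (cmod (y j - F q (node m j)))\<^sup>2 * \<tau> m j)"
    using assms(15) by (auto simp: is_arg_min_linorder)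

  \<comment> \<open>With real upper bounds \<open>S\<close> and \<open>H\<close> in place of the
    extended quantities, infinite values are left to the final case distinction.\<close>
  have bound: "sobolev_norm \<mu> \<psi> \<Lambda> \<zeta> (\<lambda>t. F f t - F p t)
      \<le> ennreal (sqrt (1 + B / A) * (S * H) + sqrt (B / A) * \<beta> * (1 + (r m)\<^sup>2) powr (\<zeta> / 2))"
    if S: "sobolev_norm \<mu> \<psi> \<Lambda> \<sigma> (F f) \<le> ennreal S" "0 \<le> S"
      and H: "S = 0 \<or> tail_sup \<psi> \<Lambda> (\<sigma> - \<zeta>) (r m) \<le> ennreal H" "0 \<le> H" for S H
  proof -
    obtain u where u: "continuous_version \<mu> (F f) u"
      and near: "\<And>x. cmod (u x - (\<Sum>k\<le>d m. L2_inner \<mu> (F f) (\<psi> k) * \<psi> k x))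
        \<le> S * H * (1 + (r m)\<^sup>2) powr (- \<zeta> / 2)"
      using continuous_version_near_projection[OF assms(1,3,2) ON cont dense low r(2) assms(10) S H]
      by blast
    show ?thesis
    proof (rule sobolev_norm_least_squares_le[OF ON _ A B, where J = "{1..L m}" and w = "\<tau> m"
          and t = "node m" and y = y and D = "d m"])
      show "F f \<in> L2_space \<mu>"
        using dense by (simp add: L2_closure_def)
      show "A * (L2_norm \<mu> q)\<^sup>2 \<le> (\<Sum>j=1..L m. (cmod (q (node m j)))\<^sup>2 * \<tau> m j)"
        if "q \<in> cfun_span (\<psi> ` {..d m})" for q
        using MZ[of q] poly[of m] that unfolding span by blast
      show "F p \<in> cfun_span (\<psi> ` {..d m})"
        unfolding span using p by blast
      show "(\<Sum>j=1..L m. (cmod (y j - F p (node m j)))\<^sup>2 * \<tau> m j)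
          \<le> (\<Sum>j=1..L m. (cmod (y j - q (node m j)))\<^sup>2 * \<tau> m j)"
        if "q \<in> cfun_span (\<psi> ` {..d m})" for q
        using that min unfolding span by blast
      show "0 \<le> \<Lambda> k \<and> \<Lambda> k \<le> r m" if "k \<le> d m" for k
        using low low_nonneg that by simp
      show "cmod (y j - (\<Sum>k\<le>d m. L2_inner \<mu> (F f) (\<psi> k) * \<psi> k (node m j)))
          \<le> \<beta> + S * H * (1 + (r m)\<^sup>2) powr (- \<zeta> / 2)" if "j \<in> {1..L m}" for j
        \<comment> \<open>The data hypothesis covers every continuous version, in particular this
          \<open>u\<close>; the triangle inequality adds its distance to the projection.\<close>
        using norm_triangle_mono[OF assms(14)[OF u that] near[of "node m j"]] by simp
      show "(\<Sum>k\<in>{d m<..n}. (cmod (L2_inner \<mu> (F f) (\<psi> k)))\<^sup>2 * (1 + (\<Lambda> k)\<^sup>2) powr \<zeta>) \<le> (S * H)\<^sup>2" for n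
        by (rule sobolev_tail_le[OF assms(1) ON low assms(11) S H])
    qed (use \<tau> weights S H assms(10,12) less_imp_le in auto)
  qed

  \<comment> \<open>This excludes the product of infinity and 0, which is 0, when the Sobolev norm
    of \<open>F f\<close> is infinite. The index \<open>Suc (d m)\<close> exists beyond the cut-off
    because the range of \<open>F\<close> has infinite dimension, and its weight is
    positive.\<close>
  have tail_pos: "tail_sup \<psi> \<Lambda> (\<sigma> - \<zeta>) (r m) \<noteq> 0"
  proof
    assume "tail_sup \<psi> \<Lambda> (\<sigma> - \<zeta>) (r m) = 0"
    moreover have "r m < \<Lambda> (Suc (d m))"
      using low[of "Suc (d m)" m] by simp
    ultimately have "(1 + (\<Lambda> (Suc (d m)))\<^sup>2) powr (- (\<sigma> - \<zeta>)) \<le> 0\<^sup>2"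
      using L2_orthonormal_unit[OF ON]
      by (intro tail_sup_term_le[OF assms(1)]) auto
    then show False
      using zero_le_power2[of "\<Lambda> (Suc (d m))"] by (simp add: add_nonneg_eq_0_iff)
  qed
  have \<kappa>: "0 < sqrt (1 + B / A)"
    using A B by (simp add: add_pos_pos)
  show ?thesis
  proof (cases "sobolev_norm \<mu> \<psi> \<Lambda> \<sigma> (F f)")
    case top
    then show ?thesis
      using \<kappa> tail_pos by (simp add: ennreal_mult_top ennreal_top_mult ennreal_mult_eq_top_iff)
  next
    case S: (real S)
    show ?thesis
    proof (cases "tail_sup \<psi> \<Lambda> (\<sigma> - \<zeta>) (r m)")
      case H: (real H)
      show ?thesis
        using bound[of S H] S H \<kappa> assms(12) A B
        by (simp add: ennreal_mult'' ennreal_plus mult.assoc)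
    next
      case top
      show ?thesis
      \<comment> \<open>For \<open>S = 0\<close> the product of 0 and infinity is 0, and
        \<open>bound\<close> with \<open>H = 0\<close> applies through its first disjunct; otherwise
        the right-hand side is infinite.\<close>
      proof (cases "S = 0")
        case True
        then show ?thesis
          using bound[of 0 0] S by simp
      next
        case False
        then show ?thesis
          using S top \<kappa> by (simp add: ennreal_mult_top ennreal_mult_eq_top_iff)
      qed
    qed
  qed
qed

end
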